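(* Let $W$ be the reflection group of type $B_N$ acting in $V=\mathbb{C}^N$, and let $m$ be a $W$-invariant multiplicity function on the root system $BC_N$ with values $m_1=m(e_i)$, $m_2=m(2e_i)$, $m_3=m(e_i\pm e_j)$ in $\mathbb{N}$. Then $$Q_m^{tr,V}(BC_N)\cong D(BCCat)^W\otimes V$$ as modules over $(SV^* )^W\otimes\mathbb{C}W$. Moreover, $\mathrm{Hom}_W(V,Q_m^{tr,V}(BC_N))\cong D(BCCat)^W$.
   Context: $\mathbb{N}=\{0,1,2,\dots\}$. $e_1,\dots,e_N$ is the standard basis of $V=\mathbb{C}^N$ with coordinates $x_1,\dots,x_N$; $SV^*=\mathbb{C}[x_1,\dots,x_N]$. The positive half of the root system $BC_N$ consists of $e_i,2e_i$ ($1\le i\le N$) and $e_i\pm e_j$ ($1\le i<j\le N$); $W$ is the group of signed permutations of coordinates, acting on $SV^*$ by $(wf)(x)=f(w^{-1}x)$. $Q_m^{tr}(BC_N)$ is the space of polynomials $p\in SV^*$ satisfying (i) $p(x+se_j)=p(x-se_j)$ whenever $x_j=0$, for $1\le j\le N$, $s=1,\dots,m_1$; (ii) $p(x+(s-\frac12)e_j)=p(x-(s-\frac12)e_j)$ whenever $x_j=0$, for $1\le j\le N$, $s=1,\dots,m_2$; (iii) $p(x\pm se_i)=p(x+se_j)$ whenever $x_j=\pm x_i$ (same choice of sign), for $i\neq j$, $s=1,\dots,m_3$. It is an $(SV^* )^W\otimes\mathbb{C}W$-module, and $Q_m^{tr,V}(BC_N)$ denotes its isotypic component of the irreducible $W$-module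 $V\cong V^*$. $BCCat$ is the affine arrangement in $V$ with defining polynomial $$P(x)=\prod_{i=1}^N\Big(x_i\prod_{j=1}^{m_1}(x_i^2-j^2)\prod_{j=1}^{m_2}(4x_i^2-(2j-1)^2)\Big)\prod_{i<j}\prod_{\epsilon\in\{\pm1\}}\Big((x_i-\epsilon x_j)\prod_{k=1}^{m_3}((x_i-\epsilon x_j)^2-k^2)\Big).$$ $\mathrm{Der}$ is the module of derivations of $SV^*$, with $W$-action $(wL)(\varphi)=w(L(w^{-1}\varphi))$. $D(BCCat)$ is the $SV^*$-module of $L\in\mathrm{Der}$ such that $L(\ell)\in\ell\,SV^*$ for every degree-one factor $\ell$ of $P$; $D(BCCat)^W$ is its subspace of $W$-invariant elements. *)

theory Defs
  imports
    "HOL-Analysis.Analysis"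
    "HOL-Library.Poly_Mapping"
    "HOL-Library.Function_Algebras"
begin

section \<open>Polynomials on \<open>V = complex ^ 'n\<close>\<close>

text \<open>The rank is \<open>N = CARD('n)\<close>. The linear order on the index type \<^typ>\<open>'n\<close>, needed in a few
  definitions below, serves only to write products and roots over \<open>i < j\<close>.\<close>

type_synonym 'n cpoly = "('n \<Rightarrow>\<^sub>0 nat) \<Rightarrow>\<^sub>0 complex"

definition Const :: "complex \<Rightarrow> 'n cpoly" where
  "Const c = Poly_Mapping.single 0 c"

definition X :: "'n \<Rightarrow> 'n cpoly" where
  "X i = Poly_Mapping.single (Poly_Mapping.single i 1) 1"

definition cscale :: "complex \<Rightarrow> 'n cpoly \<Rightarrow> 'n cpoly" where
  "cscale c p = Const c * p"

definition substitute ::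
    "(complex \<Rightarrow> 'a) \<Rightarrow> ('n::finite \<Rightarrow> 'a) \<Rightarrow> 'n cpoly \<Rightarrow> 'a::comm_ring_1" where
  "substitute h \<theta> p =
     (\<Sum>k\<in>Poly_Mapping.keys p. h (Poly_Mapping.lookup p k) * (\<Prod>i\<in>UNIV. \<theta> i ^ Poly_Mapping.lookup k i))"

definition eval :: "'n::finite cpoly \<Rightarrow> complex ^ 'n \<Rightarrow> complex" where
  "eval p x = substitute (\<lambda>c. c) (\<lambda>i. x $ i) p"

definition total_degree :: "'n::finite cpoly \<Rightarrow> nat" where
  "total_degree p =
     Max (insert 0 ((\<lambda>k. \<Sum>i\<in>UNIV. Poly_Mapping.lookup k i) ` Poly_Mapping.keys p))"

section \<open>The group \<open>W\<close> and the root system\<close>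

abbreviation e :: "'n::finite \<Rightarrow> complex ^ 'n" where
  "e i \<equiv> axis i 1"

definition W :: "(complex ^ 'n::finite \<Rightarrow> complex ^ 'n) set" where
  "W = {w. \<exists>\<sigma> \<epsilon>. bij \<sigma> \<and> (\<forall>i. \<epsilon> i \<in> {1, - 1}) \<and> w = (\<lambda>x. \<chi> i. \<epsilon> i * x $ \<sigma> i)}"

definition BC_pos :: "(complex ^ 'n::{finite,linorder}) set" where
  "BC_pos = {e i | i. True} \<union> {2 *s e i | i. True}
     \<union> {e i + e j | i j. i < j} \<union> {e i - e j | i j. i < j}"

definition BC :: "(complex ^ 'n::{finite,linorder}) set" where
  "BC = BC_pos \<union> uminus ` BC_pos"

definition W_invariant_multiplicity :: "(complex ^ 'n::{finite,linorder} \<Rightarrow> nat) \<Rightarrow> bool" where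
  "W_invariant_multiplicity m \<longleftrightarrow> (\<forall>w\<in>W. \<forall>\<alpha>\<in>BC. m (w \<alpha>) = m \<alpha>)"

text \<open>The polynomial \<open>w p\<close> with \<open>(w p)(x) = p (w\<inverse> x)\<close>, for linear bijective \<open>w\<close>: each variable
  is replaced by the corresponding coordinate of \<open>w\<inverse> x\<close>.\<close>

definition act :: "(complex ^ 'n \<Rightarrow> complex ^ 'n) \<Rightarrow> 'n::finite cpoly \<Rightarrow> 'n cpoly" where
  "act w p = substitute Const (\<lambda>i. \<Sum>j\<in>UNIV. Const (inv w (e j) $ i) * X j) p"

definition invariants :: "'n::finite cpoly set" where
  "invariants = {f. \<forall>w\<in>W. act w f = f}"

section \<open>Quasi-invariants\<close>

definition Q_tr :: "nat \<Rightarrow> nat \<Rightarrow> nat \<Rightarrow> 'n::finite cpoly set" where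
  "Q_tr m1 m2 m3 = {p.
     (\<forall>j. \<forall>s\<in>{1..m1}. \<forall>x. x $ j = 0 \<longrightarrow>
        eval p (x + of_nat s *s e j) = eval p (x - of_nat s *s e j)) \<and>
     (\<forall>j. \<forall>s\<in>{1..m2}. \<forall>x. x $ j = 0 \<longrightarrow>
        eval p (x + (of_nat s - 1 / 2) *s e j) = eval p (x - (of_nat s - 1 / 2) *s e j)) \<and>
     (\<forall>i j. i \<noteq> j \<longrightarrow> (\<forall>s\<in>{1..m3}. \<forall>\<epsilon>\<in>{1, - 1}. \<forall>x. x $ j = \<epsilon> * x $ i \<longrightarrow>
        eval p (x + (\<epsilon> * of_nat s) *s e i) = eval p (x + of_nat s *s e j)))}"

definition copies_of_V_in :: "'n::finite cpoly set \<Rightarrow> 'n cpoly set set" where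
  "copies_of_V_in M = {U. U \<subseteq> M \<and> module.subspace cscale U \<and> (\<forall>w\<in>W. act w ` U \<subseteq> U) \<and>
     (\<exists>\<phi> :: complex ^ 'n \<Rightarrow> 'n cpoly. Vector_Spaces.linear (*s) cscale \<phi> \<and> bij_betw \<phi> UNIV U \<and>
        (\<forall>w\<in>W. \<forall>v. \<phi> (w v) = act w (\<phi> v)))}"

definition Q_tr_V :: "nat \<Rightarrow> nat \<Rightarrow> nat \<Rightarrow> 'n::finite cpoly set" where
  "Q_tr_V m1 m2 m3 = module.span cscale (\<Union> (copies_of_V_in (Q_tr m1 m2 m3)))"

definition Hom_W_V :: "'n::finite cpoly set \<Rightarrow> (complex ^ 'n \<Rightarrow> 'n cpoly) set" where
  "Hom_W_V M = {\<phi>. Vector_Spaces.linear (*s) cscale \<phi> \<and> (\<forall>v. \<phi> v \<in> M) \<and>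
     (\<forall>w\<in>W. \<forall>v. \<phi> (w v) = act w (\<phi> v))}"

section \<open>The arrangement and its derivations\<close>

definition BCCat :: "nat \<Rightarrow> nat \<Rightarrow> nat \<Rightarrow> 'n::{finite,linorder} cpoly" where
  "BCCat m1 m2 m3 =
     (\<Prod>i\<in>UNIV. X i * (\<Prod>j\<in>{1..m1}. (X i)\<^sup>2 - (of_nat j)\<^sup>2)
        * (\<Prod>j\<in>{1..m2}. 4 * (X i)\<^sup>2 - (2 * of_nat j - 1)\<^sup>2))
     * (\<Prod>(i, j)\<in>{(i, j). i < j}. \<Prod>\<epsilon>\<in>{1, - 1}. (X i - \<epsilon> * X j)
        * (\<Prod>k\<in>{1..m3}. (X i - \<epsilon> * X j)\<^sup>2 - (of_nat k)\<^sup>2))"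

definition Der :: "('n cpoly \<Rightarrow> 'n cpoly) set" where
  "Der = {L. Vector_Spaces.linear cscale cscale L \<and> (\<forall>p q. L (p * q) = p * L q + q * L p)}"

definition D :: "'n::finite cpoly \<Rightarrow> ('n cpoly \<Rightarrow> 'n cpoly) set" where
  "D P = {L \<in> Der. \<forall>l. total_degree l = 1 \<and> l dvd P \<longrightarrow> l dvd L l}"

definition act_Der ::
    "(complex ^ 'n \<Rightarrow> complex ^ 'n) \<Rightarrow> ('n cpoly \<Rightarrow> 'n cpoly) \<Rightarrow> 'n::finite cpoly \<Rightarrow> 'n cpoly" where
  "act_Der w L = (\<lambda>\<phi>. act w (L (act (inv w) \<phi>)))"

definition D_W :: "'n::finite cpoly \<Rightarrow> ('n cpoly \<Rightarrow> 'n cpoly) set" where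
  "D_W P = {L \<in> D P. \<forall>w\<in>W. act_Der w L = L}"

section \<open>Tensor products over the complex numbers\<close>

text \<open>For complex subspaces \<open>A\<close> and \<open>B\<close>, with scalar multiplications \<open>sA\<close> and \<open>sB\<close>, the tensor
  product is the free vector space on \<open>A \<times> B\<close> modulo the bilinearity relations.\<close>

definition tensor_free :: "'a set \<Rightarrow> 'b set \<Rightarrow> ('a \<times> 'b \<Rightarrow>\<^sub>0 complex) set" where
  "tensor_free A B = {t. Poly_Mapping.keys t \<subseteq> A \<times> B}"

definition bilinearity_relations ::
    "(complex \<Rightarrow> 'a \<Rightarrow> 'a) \<Rightarrow> (complex \<Rightarrow> 'b \<Rightarrow> 'b) \<Rightarrow> 'a::ab_group_add set \<Rightarrow> 'b::ab_group_add set
      \<Rightarrow> ('a \<times> 'b \<Rightarrow>\<^sub>0 complex) set" where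
  "bilinearity_relations sA sB A B =
     (let \<delta> = (\<lambda>a b. Poly_Mapping.single (a, b) 1) in
       {\<delta> (a + a') b - \<delta> a b - \<delta> a' b | a a' b. a \<in> A \<and> a' \<in> A \<and> b \<in> B}
     \<union> {\<delta> a (b + b') - \<delta> a b - \<delta> a b' | a b b'. a \<in> A \<and> b \<in> B \<and> b' \<in> B}
     \<union> {\<delta> (sA c a) b - Poly_Mapping.single (a, b) c | c a b. a \<in> A \<and> b \<in> B}
     \<union> {\<delta> a (sB c b) - Poly_Mapping.single (a, b) c | c a b. a \<in> A \<and> b \<in> B})"

definition tensor_rel ::
    "(complex \<Rightarrow> 'a \<Rightarrow> 'a) \<Rightarrow> (complex \<Rightarrow> 'b \<Rightarrow> 'b) \<Rightarrow> 'a::ab_group_add set \<Rightarrow> 'b::ab_group_add set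
      \<Rightarrow> (('a \<times> 'b \<Rightarrow>\<^sub>0 complex) \<times> ('a \<times> 'b \<Rightarrow>\<^sub>0 complex)) set" where
  "tensor_rel sA sB A B = {(s, t). s \<in> tensor_free A B \<and> t \<in> tensor_free A B \<and>
     s - t \<in> module.span (\<lambda>c. Poly_Mapping.map ((*) c)) (bilinearity_relations sA sB A B)}"

section \<open>Modules and their isomorphisms\<close>

record ('r, 'x) module_data =
  elements :: "'x set"
  madd :: "'x \<Rightarrow> 'x \<Rightarrow> 'x"
  msmult :: "'r \<Rightarrow> 'x \<Rightarrow> 'x"

definition module_isomorphic :: "'r set \<Rightarrow> ('r, 'x) module_data \<Rightarrow> ('r, 'y) module_data \<Rightarrow> bool" where
  "module_isomorphic R M N \<longleftrightarrow> (\<exists>F. bij_betw F (elements M) (elements N) \<and>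
     (\<forall>x\<in>elements M. \<forall>y\<in>elements M. F (madd M x y) = madd N (F x) (F y)) \<and>
     (\<forall>r\<in>R. \<forall>x\<in>elements M. F (msmult M r x) = msmult N r (F x)))"

text \<open>Since \<open>W\<close> is a finite basis of its group algebra, every element of the tensor product of
  \<^const>\<open>invariants\<close> with this group algebra is uniquely a sum of terms \<open>a w \<otimes> w\<close> over \<open>w \<in> W\<close>.
  It is represented here by its coefficient function \<open>a\<close>.\<close>

definition invariants_W :: "((complex ^ 'n::finite \<Rightarrow> complex ^ 'n) \<Rightarrow> 'n cpoly) set" where
  "invariants_W = {a. (\<forall>w\<in>W. a w \<in> invariants) \<and> (\<forall>w. w \<notin> W \<longrightarrow> a w = 0)}"

definition Q_tr_V_module :: "nat \<Rightarrow> nat \<Rightarrow> nat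
    \<Rightarrow> ((complex ^ 'n \<Rightarrow> complex ^ 'n) \<Rightarrow> 'n::finite cpoly, 'n cpoly) module_data" where
  "Q_tr_V_module m1 m2 m3 =
     \<lparr>elements = Q_tr_V m1 m2 m3, madd = (+), msmult = (\<lambda>a q. \<Sum>w\<in>W. a w * act w q)\<rparr>"

definition scale_Der :: "'n cpoly \<Rightarrow> ('n cpoly \<Rightarrow> 'n cpoly) \<Rightarrow> 'n cpoly \<Rightarrow> 'n cpoly" where
  "scale_Der f L = (\<lambda>p. f * L p)"

text \<open>The module of \<open>L \<otimes> v\<close> with \<open>L \<in> D_W P\<close> and \<open>v \<in> V\<close>, where
  \<open>(f \<otimes> w) (L \<otimes> v) = f L \<otimes> w v\<close>.\<close>

definition D_W_tensor_V_module :: "'n::finite cpoly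
    \<Rightarrow> ((complex ^ 'n \<Rightarrow> complex ^ 'n) \<Rightarrow> 'n cpoly,
        (('n cpoly \<Rightarrow> 'n cpoly) \<times> (complex ^ 'n) \<Rightarrow>\<^sub>0 complex) set) module_data" where
  "D_W_tensor_V_module P =
     (let A = D_W P; B = UNIV; E = tensor_rel (\<lambda>c. scale_Der (Const c)) (*s) A B in
      \<lparr>elements = tensor_free A B // E,
       madd = (\<lambda>S T. \<Union>s\<in>S. \<Union>t\<in>T. E `` {s + t}),
       msmult = (\<lambda>a T. \<Union>t\<in>T. E `` {\<Sum>w\<in>W. \<Sum>(L, v)\<in>Poly_Mapping.keys t.
          Poly_Mapping.single (scale_Der (a w) L, w v) (Poly_Mapping.lookup t (L, v))})\<rparr>)"

definition Hom_W_V_module ::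
    "'n::finite cpoly set \<Rightarrow> ('n cpoly, complex ^ 'n \<Rightarrow> 'n cpoly) module_data" where
  "Hom_W_V_module M = \<lparr>elements = Hom_W_V M, madd = (+), msmult = (\<lambda>f \<phi> v. f * \<phi> v)\<rparr>"

definition D_W_module ::
    "'n::finite cpoly \<Rightarrow> ('n cpoly, 'n cpoly \<Rightarrow> 'n cpoly) module_data" where
  "D_W_module P = \<lparr>elements = D_W P, madd = (+), msmult = scale_Der\<rparr>"

end

theory Submission
  imports Defs "HOL-Computational_Algebra.Polynomial"
begin

text \<open>A derivation \<open>L\<close> is determined by the polynomials \<open>L (X i)\<close>, that is, by a linear map
  \<open>V \<rightarrow> SV\<^sup>*\<close>, \<open>e\<^sub>i \<mapsto> L (X i)\<close>. Since \<open>W\<close> acts by orthogonal matrices, \<open>L\<close> is invariant iff this map is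
  equivariant. Under this correspondence, divisibility of \<open>L \<ell>\<close> by \<open>\<ell>\<close> for the affine factors \<open>\<ell>\<close> of
  the arrangement says that certain components, or differences of components, of the equivariant
  polynomial vector field vanish on shifted hyperplanes; by equivariance these are exactly the
  quasi-invariance conditions on the components. The isotypic component is then spanned by the
  values of such maps, and the sum of the lines \<open>L (X i)\<close> is direct because the sign changes in \<open>W\<close>
  separate them.\<close>

section \<open>Polynomials as functions\<close>

text \<open>\<open>D P\<close> tests every degree-one divisor of \<open>P\<close>, not a given list
  of factors; affine forms are therefore shown to be prime, so that each such divisor is a scalar
  multiple of a listed factor. Divisibility by an affine form becomes vanishing on its hyperplane,
  the language in which \<open>Q_tr\<close> is written; this needs that polynomials, which are
  formal coefficient maps, are determined by their values. The factors with shift 0,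
  \<open>X i\<close> and \<open>X i - \<epsilon> * X j\<close>, match no condition in
  \<open>Q_tr\<close>: an equivariant field satisfies them automatically, because its value at a
  point fixed by a reflection is fixed by that reflection. The tensor product is a quotient of a
  free space, and its elements are compared through \<open>realize\<close>, which sends
  \<open>L\<close> tensor \<open>v\<close> to \<open>hom_of L v\<close>. Every tensor has a normal
  form in which \<open>v\<close> runs through the basis \<open>e i\<close>; with the independence of
  the components this makes the classes exactly the fibres of \<open>realize\<close>, and the
  isomorphism can send a polynomial to its fibre.\<close>

lemma poly_mapping_sum_single:
  "(\<Sum>k\<in>Poly_Mapping.keys p. Poly_Mapping.single k (Poly_Mapping.lookup p k)) = p"
proof (rule poly_mapping_eqI)
  fix k
  have "Poly_Mapping.lookup (\<Sum>k\<in>Poly_Mapping.keys p. Poly_Mapping.single k (Poly_Mapping.lookup p k)) k =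
    (\<Sum>j\<in>Poly_Mapping.keys p. if j = k then Poly_Mapping.lookup p k else 0)"
    unfolding lookup_sum by (intro sum.cong) (auto simp: lookup_single when_def)
  then show "Poly_Mapping.lookup (\<Sum>k\<in>Poly_Mapping.keys p. Poly_Mapping.single k (Poly_Mapping.lookup p k)) k
    = Poly_Mapping.lookup p k"
    by (simp add: in_keys_iff)
qed

lemma poly_mapping_single_induct [case_names single add]:
  fixes p :: "'a \<Rightarrow>\<^sub>0 'b::comm_monoid_add"
  assumes "\<And>k c. P (Poly_Mapping.single k c)" and "\<And>p q. P p \<Longrightarrow> P q \<Longrightarrow> P (p + q)"
  shows "P p"
proof -
  have "P (\<Sum>k\<in>K. Poly_Mapping.single k (Poly_Mapping.lookup p k))" for K
  proof (induction K rule: infinite_finite_induct)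
    case (insert k K)
    then show ?case by (simp add: assms)
  qed (use assms(1)[of _ 0] in \<open>simp_all\<close>)
  from this[of "Poly_Mapping.keys p"] show ?thesis by (simp add: poly_mapping_sum_single)
qed

section \<open>Constants and variables as ring generators\<close>

lemma Const_add: "Const (a + b) = Const a + Const b"
  by (simp add: Const_def single_add)

lemma Const_mult: "Const (a * b) = Const a * Const b"
  by (simp add: Const_def mult_single)

lemma Const_0 [simp]: "Const 0 = 0"
  by (simp add: Const_def)

lemma Const_1 [simp]: "Const 1 = 1"
  by (simp add: Const_def)

lemma Const_uminus: "Const (- a) = - Const a"
  by (simp add: Const_def single_uminus)

lemma Const_of_nat: "Const (of_nat k) = of_nat k"
  by (simp add: Const_def)

lemma Const_numeral: "Const (numeral k) = numeral k"
  by (simp add: Const_def)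

lemma Const_sum: "Const (sum f A) = (\<Sum>a\<in>A. Const (f a))"
  by (induction A rule: infinite_finite_induct) (simp_all add: Const_add)

lemma prod_X_power:
  assumes "finite S"
  shows "(\<Prod>i\<in>S. X i ^ f i) = Poly_Mapping.single (\<Sum>i\<in>S. Poly_Mapping.single i (f i)) 1"
proof -
  have "X i ^ k = Poly_Mapping.single (Poly_Mapping.single i k) 1" for i :: 'a and k
    by (induction k) (simp_all add: X_def mult_single flip: single_add)
  with assms show ?thesis
    by (induction S rule: finite_induct) (simp_all add: mult_single)
qed

lemma single_eq_monomial:
  fixes k :: "'n::finite \<Rightarrow>\<^sub>0 nat"
  shows "Poly_Mapping.single k c = Const c * (\<Prod>i\<in>UNIV. X i ^ Poly_Mapping.lookup k i)"
proof -
  have "(\<Sum>i\<in>UNIV. Poly_Mapping.single i (Poly_Mapping.lookup k i)) = k"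
    by (rule poly_mapping_eqI) (simp add: lookup_sum lookup_single when_def)
  then show ?thesis
    by (simp add: prod_X_power Const_def mult_single)
qed

text \<open>Reduces identities between homomorphisms or derivations, and congruences modulo an
  affine form, to the ring generators.\<close>

lemma cpoly_induct [case_names Const X add mult]:
  fixes p :: "'n::finite cpoly"
  assumes Const: "\<And>c. P (Const c)" and X: "\<And>i. P (X i)"
    and add: "\<And>p q. P p \<Longrightarrow> P q \<Longrightarrow> P (p + q)" and mult: "\<And>p q. P p \<Longrightarrow> P q \<Longrightarrow> P (p * q)"
  shows "P p"
proof (induction p rule: poly_mapping_single_induct)
  case (single k c)
  have P1: "P 1" using Const[of 1] by simp
  have "P (X i ^ j)" for i j by (induction j) (use P1 X mult in \<open>auto\<close>)
  then have "P (\<Prod>i\<in>S. X i ^ Poly_Mapping.lookup k i)" for S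
    by (induction S rule: infinite_finite_induct) (use P1 mult in \<open>auto\<close>)
  then show ?case by (simp add: single_eq_monomial Const mult)
qed (rule add)

text \<open>The universal property of the polynomial ring is proved once for three targets: complex
  numbers (evaluation), polynomials (the action of \<open>W\<close> and the elimination of a
  variable), and polynomials in an extra variable (first-order deformations, which produce
  derivations).\<close>

locale coeff_hom =
  fixes h :: "complex \<Rightarrow> 'a::comm_ring_1"
  assumes h_add: "h (a + b) = h a + h b" and h_mult: "h (a * b) = h a * h b" and h_1: "h 1 = 1"
begin

lemma h_0: "h 0 = 0"
  using h_add[of 0 0] by simp

lemma substitute_superset:
  assumes "finite K" and "Poly_Mapping.keys p \<subseteq> K"
  shows "substitute h \<theta> p =
    (\<Sum>k\<in>K. h (Poly_Mapping.lookup p k) * (\<Prod>i\<in>UNIV. \<theta> i ^ Poly_Mapping.lookup k i))"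
  unfolding substitute_def
  by (rule sum.mono_neutral_left[OF assms]) (auto simp: in_keys_iff h_0)

lemma substitute_add: "substitute h \<theta> (p + q) = substitute h \<theta> p + substitute h \<theta> q"
proof -
  let ?K = "Poly_Mapping.keys p \<union> Poly_Mapping.keys q"
  have "Poly_Mapping.keys (p + q) \<subseteq> ?K" by (rule keys_add)
  then show ?thesis
    by (simp add: substitute_superset[of ?K] lookup_add h_add distrib_right sum.distrib)
qed

lemma substitute_single:
  "substitute h \<theta> (Poly_Mapping.single k c) = h c * (\<Prod>i\<in>UNIV. \<theta> i ^ Poly_Mapping.lookup k i)"
  by (simp add: substitute_superset[of "{k}"])

lemma substitute_mult: "substitute h \<theta> (p * q) = substitute h \<theta> p * substitute h \<theta> q"
proof (induction p rule: poly_mapping_single_induct)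
  case (single k c)
  show ?case
  proof (induction q rule: poly_mapping_single_induct)
    case (single j d)
    then show ?case
      by (simp add: mult_single substitute_single h_mult lookup_add power_add prod.distrib)
  qed (simp add: algebra_simps substitute_add)
qed (simp add: algebra_simps substitute_add)

lemma substitute_Const [simp]: "substitute h \<theta> (Const c) = h c"
  by (simp add: Const_def substitute_single)

lemma substitute_X [simp]: "substitute h \<theta> (X i) = \<theta> i"
proof -
  have "\<theta> i' ^ Poly_Mapping.lookup (Poly_Mapping.single i (Suc 0)) i' = (if i' = i then \<theta> i else 1)" for i'
    by (simp add: lookup_single when_def)
  then show ?thesis by (simp add: X_def substitute_single h_1)
qed

lemma substitute_0 [simp]: "substitute h \<theta> 0 = 0"
  by (simp add: substitute_def)

lemma substitute_1 [simp]: "substitute h \<theta> 1 = 1"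
  using substitute_Const[of \<theta> 1] by (simp add: h_1)

lemma substitute_uminus: "substitute h \<theta> (- p) = - substitute h \<theta> p"
  using substitute_add[of \<theta> p "- p"] by (simp add: eq_neg_iff_add_eq_0 add.commute)

lemma substitute_diff: "substitute h \<theta> (p - q) = substitute h \<theta> p - substitute h \<theta> q"
  using substitute_add[of \<theta> p "- q"] by (simp add: substitute_uminus)

lemma substitute_sum: "substitute h \<theta> (sum f A) = (\<Sum>a\<in>A. substitute h \<theta> (f a))"
  by (induction A rule: infinite_finite_induct) (simp_all add: substitute_add)

end

interpretation Const_hom: coeff_hom Const
  by unfold_locales (simp_all add: Const_add Const_mult)

interpretation id_hom: coeff_hom "\<lambda>c. c"
  by unfold_locales simp_all

section \<open>Evaluation at points and its faithfulness\<close>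

lemma eval_simps [simp]:
  "eval (p + q) x = eval p x + eval q x" "eval (p * q) x = eval p x * eval q x"
  "eval (p - q) x = eval p x - eval q x" "eval (- p) x = - eval p x"
  "eval (Const c) x = c" "eval (X i) x = x $ i" "eval 0 x = 0" "eval 1 x = 1"
  by (simp_all add: eval_def id_hom.substitute_add id_hom.substitute_mult id_hom.substitute_diff
      id_hom.substitute_uminus)

lemma eval_sum [simp]: "eval (sum f A) x = (\<Sum>a\<in>A. eval (f a) x)"
  by (simp add: eval_def id_hom.substitute_sum)

lemma eval_power [simp]: "eval (p ^ k) x = eval p x ^ k"
  by (induction k) simp_all

lemma eval_of_nat [simp]: "eval (of_nat k) x = of_nat k"
  by (simp flip: Const_of_nat)

lemma eval_numeral [simp]: "eval (numeral k) x = numeral k"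
  by (simp flip: Const_numeral)

text \<open>Distinct monomials are distinct characters of the multiplicative monoid \<open>complex ^ 'n\<close>, so
  Dedekind's argument gives their linear independence.\<close>

lemma monomials_independent:
  fixes K :: "('n::finite \<Rightarrow>\<^sub>0 nat) set"
  assumes "finite K"
    and "\<And>x :: complex ^ 'n. (\<Sum>k\<in>K. c k * (\<Prod>i\<in>UNIV. (x $ i) ^ Poly_Mapping.lookup k i)) = 0"
    and "k \<in> K"
  shows "c k = 0"
  using assms
proof (induction K arbitrary: c k rule: finite_induct)
  case (insert k0 K)
  define mon where "mon k x = (\<Prod>i\<in>UNIV. (x $ i) ^ Poly_Mapping.lookup k i)"
    for k :: "'n \<Rightarrow>\<^sub>0 nat" and x :: "complex ^ 'n"
  have mon_mult: "mon k (\<chi> i. x $ i * y $ i) = mon k x * mon k y" for k x y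
    by (simp add: mon_def power_mult_distrib prod.distrib)
  have sum0: "c k0 * mon k0 x + (\<Sum>k\<in>K. c k * mon k x) = 0" for x
    using insert by (simp add: mon_def)
  have S: "(\<Sum>k\<in>K. c k * mon k x) = - (c k0 * mon k0 x)" for x
    using minus_unique[OF sum0[of x]] by simp
  \<comment> \<open>The relation at the coordinatewise product of \<open>x\<close> and
    \<open>y\<close>, minus \<open>mon k0 y\<close> times the relation at \<open>x\<close>: the term
    of \<open>k0\<close> cancels, so the induction hypothesis applies.\<close>
  have *: "c k * (mon k y - mon k0 y) = 0" if "k \<in> K" for k y
  proof (rule insert.IH[OF _ that, of "\<lambda>k. c k * (mon k y - mon k0 y)"])
    fix x
    have "(\<Sum>k\<in>K. c k * (mon k y - mon k0 y) * mon k x) =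
      (\<Sum>k\<in>K. c k * (mon k x * mon k y)) - mon k0 y * (\<Sum>k\<in>K. c k * mon k x)"
      by (simp add: sum_distrib_left sum_subtractf algebra_simps)
    also have "\<dots> = (- (c k0 * (mon k0 x * mon k0 y))) - mon k0 y * (- (c k0 * mon k0 x))"
      using S[of "\<chi> i. x $ i * y $ i"] by (simp only: mon_mult S[of x])
    also have "\<dots> = 0" by simp
    finally show "(\<Sum>k\<in>K. c k * (mon k y - mon k0 y) * (\<Prod>i\<in>UNIV. (x $ i) ^ Poly_Mapping.lookup k i)) = 0"
      by (simp add: mon_def)
  qed
  have cK: "c k = 0" if "k \<in> K" for k
  proof -
    have "k \<noteq> k0" using that insert by auto
    then obtain i where i: "Poly_Mapping.lookup k i \<noteq> Poly_Mapping.lookup k0 i"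
      using poly_mapping_eqI[of k k0] by auto
    \<comment> \<open>At this point a monomial takes the value 2 to its exponent in variable
      \<open>i\<close>, and distinct exponents give distinct powers of 2.\<close>
    have "mon k' (\<chi> j. if j = i then 2 else 1) = 2 ^ Poly_Mapping.lookup k' i" for k'
    proof -
      have "mon k' (\<chi> j. if j = i then 2 else 1) =
        (\<Prod>j\<in>UNIV. if j = i then 2 ^ Poly_Mapping.lookup k' i else 1)"
        unfolding mon_def by (intro prod.cong) auto
      then show ?thesis by simp
    qed
    moreover have "(2::complex) ^ Poly_Mapping.lookup k i \<noteq> 2 ^ Poly_Mapping.lookup k0 i"
    proof -
      have "of_nat (2 ^ Poly_Mapping.lookup k i) \<noteq> (of_nat (2 ^ Poly_Mapping.lookup k0 i) :: complex)"
        using i by (simp only: of_nat_eq_iff power_inject_exp[of 2] one_less_numeral_iff) simp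
      then show ?thesis by simp
    qed
    ultimately show ?thesis using *[OF that, of "\<chi> j. if j = i then 2 else 1"] by auto
  qed
  have "c k0 = 0"
    using sum0[of "\<chi> i. 1"] cK by (simp add: mon_def)
  then show ?case using cK insert.prems by auto
qed simp

lemma eval_eq_0_imp:
  fixes p :: "'n::finite cpoly"
  assumes "\<And>x. eval p x = 0"
  shows "p = 0"
proof (rule poly_mapping_eqI)
  fix k
  have "Poly_Mapping.lookup p k = 0" if "k \<in> Poly_Mapping.keys p"
  proof (rule monomials_independent[OF finite_keys _ that])
    show "(\<Sum>k\<in>Poly_Mapping.keys p. Poly_Mapping.lookup p k * (\<Prod>i\<in>UNIV. (x $ i) ^ Poly_Mapping.lookup k i)) = 0"
      for x
      using assms[of x] by (simp add: eval_def substitute_def)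
  qed
  then show "Poly_Mapping.lookup p k = Poly_Mapping.lookup 0 k"
    by (auto simp: in_keys_iff)
qed

lemma cpoly_eqI:
  fixes p q :: "'n::finite cpoly"
  assumes "\<And>x. eval p x = eval q x"
  shows "p = q"
  using eval_eq_0_imp[of "p - q"] assms by simp

section \<open>Invariant derivations and equivariant maps\<close>

interpretation cpoly: vector_space cscale
  by unfold_locales (simp_all add: cscale_def Const_add Const_mult algebra_simps)

section \<open>Signed permutations as orthogonal matrices\<close>

lemma W_E:
  assumes "w \<in> W"
  obtains \<sigma> \<epsilon> where "bij \<sigma>" "\<And>i. \<epsilon> i * \<epsilon> i = 1" "\<And>x i. w x $ i = \<epsilon> i * x $ \<sigma> i"
    "inv w = (\<lambda>x. \<chi> i. \<epsilon> (inv \<sigma> i) * x $ inv \<sigma> i)" "bij w" "inv w \<in> W"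
proof -
  obtain \<sigma> \<epsilon> where \<sigma>: "bij \<sigma>" and \<epsilon>: "\<And>i. \<epsilon> i \<in> {1, - 1}" and w: "w = (\<lambda>x. \<chi> i. \<epsilon> i * x $ \<sigma> i)"
    using assms unfolding W_def by blast
  have \<epsilon>2: "\<epsilon> i * \<epsilon> i = 1" for i using \<epsilon>[of i] by auto
  \<comment> \<open>Solving \<open>y $ i = \<epsilon> i * x $ \<sigma> i\<close> for
    \<open>x\<close>: a sign is its own inverse and travels with its coordinate, hence
    \<open>\<epsilon> (inv \<sigma> i)\<close>.\<close>
  define u where "u = (\<lambda>x :: complex ^ 'a. \<chi> i. \<epsilon> (inv \<sigma> i) * x $ inv \<sigma> i)"
  have \<sigma>': "\<sigma> (inv \<sigma> i) = i" "inv \<sigma> (\<sigma> i) = i" for i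
    using \<sigma> by (simp_all add: bij_is_surj surj_f_inv_f bij_is_inj)
  have wu: "w (u x) = x" "u (w x) = x" for x
    using \<epsilon>2 by (auto simp: w u_def vec_eq_iff \<sigma>' simp flip: mult.assoc)
  have "bij w" by (rule o_bij[of u]) (use wu in \<open>auto simp: fun_eq_iff\<close>)
  moreover have inv: "inv w = u" by (rule inv_equality) (use wu in auto)
  moreover have "u \<in> W"
    unfolding W_def u_def using \<sigma> \<epsilon> by (auto intro!: exI[of _ "inv \<sigma>"] exI[of _ "\<lambda>i. \<epsilon> (inv \<sigma> i)"] bij_imp_bij_inv)
  ultimately show ?thesis
    using that[of \<sigma> \<epsilon>] \<sigma> \<epsilon>2 by (simp add: w u_def)
qed

lemma W_I:
  assumes "bij \<sigma>" and "\<And>i. \<epsilon> i \<in> {1, - 1}"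
  shows "(\<lambda>x. \<chi> i. \<epsilon> i * x $ \<sigma> i) \<in> W"
  using assms unfolding W_def by blast

lemma W_bij: "w \<in> W \<Longrightarrow> bij w" and W_inv: "w \<in> W \<Longrightarrow> inv w \<in> W"
  by (metis W_E)+

lemma W_inv_inv: "w \<in> W \<Longrightarrow> inv (inv w) = w"
  by (simp add: W_bij inv_inv_eq)

lemma W_inv_left [simp]: "w \<in> W \<Longrightarrow> inv w (w x) = x"
  by (simp add: W_bij bij_is_inj)

lemma W_inv_right [simp]: "w \<in> W \<Longrightarrow> w (inv w x) = x"
  by (simp add: W_bij bij_is_surj surj_f_inv_f)

text \<open>Orthogonality: both sides are \<open>\<epsilon> j\<close> if
  \<open>\<sigma> j = i\<close> and 0 otherwise. It removes the inverse from \<open>act\<close> on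
  variables and identifies \<open>V\<close> with its dual as a representation.\<close>

lemma W_transpose: "w \<in> W \<Longrightarrow> inv w (e j) $ i = w (e i) $ j"
proof (erule W_E)
  fix \<sigma> \<epsilon>
  assume *: "bij \<sigma>" "\<And>x i. w x $ i = \<epsilon> i * x $ \<sigma> i"
    "inv w = (\<lambda>x. \<chi> i. \<epsilon> (inv \<sigma> i) * x $ inv \<sigma> i)"
  then show ?thesis
    by (auto simp: axis_def bij_is_surj surj_f_inv_f bij_is_inj)
qed

lemma W_expand:
  assumes "w \<in> W"
  shows "w x $ i = (\<Sum>j\<in>UNIV. w (e j) $ i * x $ j)"
proof -
  obtain \<sigma> \<epsilon> where w: "\<And>x i. w x $ i = \<epsilon> i * x $ \<sigma> i" using assms by (rule W_E) blast
  show ?thesis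
    by (simp add: w axis_def if_distrib[of "\<lambda>c. _ * c"] if_distrib[of "\<lambda>c. c * _"] cong: if_cong)
qed

lemma act_simps [simp]:
  "act w (p + q) = act w p + act w q" "act w (p * q) = act w p * act w q"
  "act w (p - q) = act w p - act w q" "act w (Const c) = Const c" "act w 0 = 0"
  by (simp_all add: act_def Const_hom.substitute_add Const_hom.substitute_mult Const_hom.substitute_diff)

lemma act_sum: "act w (sum f A) = (\<Sum>a\<in>A. act w (f a))"
  by (simp add: act_def Const_hom.substitute_sum)

lemma act_X:
  assumes "w \<in> W"
  shows "act w (X i) = (\<Sum>j\<in>UNIV. Const (w (e i) $ j) * X j)"
  by (simp add: act_def W_transpose[OF assms])

lemma eval_act:
  assumes "w \<in> W"
  shows "eval (act w p) x = eval p (inv w x)"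
proof (induction p rule: cpoly_induct)
  case (X i)
  then show ?case using W_expand[OF W_inv[OF assms], of x i]
    by (simp add: act_X[OF assms] W_transpose[OF assms])
qed simp_all

lemma act_inv_act [simp]: "w \<in> W \<Longrightarrow> act (inv w) (act w p) = p"
  by (rule cpoly_eqI) (simp add: eval_act W_inv W_inv_inv)

lemma act_act_inv [simp]: "w \<in> W \<Longrightarrow> act w (act (inv w) p) = p"
  by (rule cpoly_eqI) (simp add: eval_act W_inv W_inv_inv)

section \<open>Derivations as prescribed values on the variables\<close>

lemma Der_iff:
  "L \<in> Der \<longleftrightarrow> (\<forall>p q. L (p + q) = L p + L q) \<and> (\<forall>c p. L (Const c * p) = Const c * L p)
     \<and> (\<forall>p q. L (p * q) = p * L q + q * L p)"
  by (auto simp: Der_def Vector_Spaces.linear_iff cpoly.vector_space_axioms cscale_def)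

lemma Der_D:
  assumes "L \<in> Der"
  shows "L (p + q) = L p + L q" "L (Const c * p) = Const c * L p" "L (p * q) = p * L q + q * L p"
    "L (Const c) = 0"
proof -
  show *: "L (p + q) = L p + L q" "L (Const c * p) = Const c * L p" "L (p * q) = p * L q + q * L p" for p q c
    using assms by (auto simp: Der_iff)
  have "L 1 = 0" using *(3)[of 1 1] by simp
  then show "L (Const c) = 0" using *(2)[of c 1] by simp
qed

lemma Der_diff: "L \<in> Der \<Longrightarrow> L (p - q) = L p - L q"
  using Der_D(1)[of L "p - q" q] by simp

lemma Der_0: "L \<in> Der \<Longrightarrow> L 0 = 0"
  using Der_D(4)[of L 0] by simp

lemma Der_sum: "L \<in> Der \<Longrightarrow> L (sum f A) = (\<Sum>a\<in>A. L (f a))"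
  by (induction A rule: infinite_finite_induct) (simp_all add: Der_0 Der_D)

lemma Der_eqI:
  fixes L L' :: "'n::finite cpoly \<Rightarrow> 'n cpoly"
  assumes "L \<in> Der" "L' \<in> Der" "\<And>i. L (X i) = L' (X i)"
  shows "L = L'"
proof
  fix p
  show "L p = L' p"
    by (induction p rule: cpoly_induct) (use assms in \<open>simp_all add: Der_D\<close>)
qed

text \<open>The linear coefficient in \<open>t\<close> of \<open>p (X + t g)\<close>.\<close>

definition derivation :: "('n \<Rightarrow> 'n cpoly) \<Rightarrow> 'n::finite cpoly \<Rightarrow> 'n cpoly" where
  "derivation g p = coeff (substitute (\<lambda>c. [:Const c:]) (\<lambda>i. [:X i, g i:]) p) 1"

interpretation poly_hom: coeff_hom "\<lambda>c. [:Const c:]"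
  by unfold_locales (simp_all add: Const_add Const_mult)

lemma derivation_X [simp]: "derivation g (X i) = g i"
  by (simp add: derivation_def)

lemma derivation_Der: "derivation g \<in> Der"
proof -
  \<comment> \<open>Modulo \<open>t\<close> the substitution is the identity. With this, the
    coefficient of \<open>t\<close> in a product is the Leibniz formula.\<close>
  have "coeff (substitute (\<lambda>c. [:Const c:]) (\<lambda>i. [:X i, g i:]) p) 0 = p" for p
    by (induction p rule: cpoly_induct)
      (simp_all add: poly_hom.substitute_add poly_hom.substitute_mult coeff_mult)
  then show ?thesis
    by (simp add: Der_iff derivation_def poly_hom.substitute_add poly_hom.substitute_mult coeff_mult
        mult.commute)
qed

text \<open>The restriction of a derivation to \<open>V\<^sup>*\<close>, which is identified with \<open>V\<close> by the standard bilinear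
  form.\<close>

definition hom_of :: "('n cpoly \<Rightarrow> 'n cpoly) \<Rightarrow> complex ^ 'n \<Rightarrow> 'n::finite cpoly" where
  "hom_of L v = (\<Sum>i\<in>UNIV. Const (v $ i) * L (X i))"

lemma hom_of_e [simp]: "hom_of L (e i) = L (X i)"
proof -
  have "Const (e i $ j) * L (X j) = (if i = j then L (X i) else 0)" for j
    by (simp add: axis_def)
  then show ?thesis by (simp add: hom_of_def)
qed

lemma hom_of_add: "hom_of L (v + v') = hom_of L v + hom_of L v'"
  by (simp add: hom_of_def Const_add distrib_right sum.distrib)

lemma hom_of_scale: "hom_of L (c *s v) = Const c * hom_of L v"
  by (simp add: hom_of_def Const_mult sum_distrib_left mult.assoc)

lemma hom_of_add_left: "hom_of (L + L') v = hom_of L v + hom_of L' v"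
  by (simp add: hom_of_def distrib_left sum.distrib)

lemma hom_of_scale_Der: "hom_of (scale_Der f L) v = f * hom_of L v"
  by (simp add: hom_of_def scale_Der_def sum_distrib_left mult.left_commute)

lemma vec_expand: "v = (\<Sum>i\<in>UNIV. v $ i *s e i)"
  for v :: "complex ^ 'n::finite"
  by (simp add: basis_expansion)

lemma linear_hom_of: "Vector_Spaces.linear (*s) cscale (hom_of L)"
  by (simp add: Vector_Spaces.linear_iff cpoly.vector_space_axioms vec.vector_space_axioms
      hom_of_add hom_of_scale cscale_def)

lemma hom_of_unique:
  assumes "Vector_Spaces.linear (*s) cscale \<phi>" "\<And>i. L (X i) = \<phi> (e i)"
  shows "hom_of L = \<phi>"
proof
  fix v
  interpret Vector_Spaces.linear "(*s)" cscale \<phi> by fact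
  have "\<phi> v = (\<Sum>i\<in>UNIV. \<phi> (v $ i *s e i))"
    by (subst (1) vec_expand) (simp add: sum)
  also have "\<dots> = hom_of L v"
    by (simp add: scale hom_of_def cscale_def assms)
  finally show "hom_of L v = \<phi> v" ..
qed

text \<open>By orthogonality \<open>w\<close> carries the linear form \<open>X i\<close> to the form
  with coefficient vector \<open>w (e i)\<close>.\<close>

lemma Der_act_X:
  assumes "L \<in> Der" "w \<in> W"
  shows "L (act w (X i)) = hom_of L (w (e i))"
  by (simp add: act_X[OF assms(2)] Der_sum[OF assms(1)] Der_D[OF assms(1)] hom_of_def)

definition invariant_Der :: "('n::finite cpoly \<Rightarrow> 'n cpoly) set" where
  "invariant_Der = {L \<in> Der. \<forall>w\<in>W. act_Der w L = L}"

lemma D_W_eq: "D_W P = D P \<inter> invariant_Der"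
  by (auto simp: D_W_def invariant_Der_def D_def)

lemma invariant_Der_act:
  assumes "L \<in> invariant_Der" "w \<in> W"
  shows "L (act w p) = act w (L p)"
proof -
  have "act_Der w L = L" using assms by (simp add: invariant_Der_def)
  then have "act_Der w L (act w p) = L (act w p)" by simp
  then show ?thesis by (simp add: act_Der_def assms)
qed

text \<open>Both sides say that \<open>L\<close> commutes with \<open>w\<close>. The right side says
  so on linear forms, which suffices because \<open>L\<close> is a derivation and
  \<open>act w\<close> a ring homomorphism.\<close>

lemma invariant_Der_iff:
  "L \<in> invariant_Der \<longleftrightarrow> L \<in> Der \<and> (\<forall>w\<in>W. \<forall>v. hom_of L (w v) = act w (hom_of L v))"
  (is "?A \<longleftrightarrow> ?B")
proof
  assume A: ?A
  then have Der: "L \<in> Der" by (simp add: invariant_Der_def)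
  have "hom_of L (w v) = act w (hom_of L v)" if w: "w \<in> W" for w v
  proof -
    have "act w (hom_of L v) = (\<Sum>i\<in>UNIV. Const (v $ i) * hom_of L (w (e i)))"
      unfolding hom_of_def[of L v] act_sum
      by (simp add: Der_act_X[OF Der w] flip: invariant_Der_act[OF A w])
    also have "\<dots> = (\<Sum>i\<in>UNIV. \<Sum>j\<in>UNIV. Const (w (e i) $ j * v $ i) * L (X j))"
      by (simp add: hom_of_def sum_distrib_left Const_mult mult_ac)
    also have "\<dots> = (\<Sum>j\<in>UNIV. \<Sum>i\<in>UNIV. Const (w (e i) $ j * v $ i) * L (X j))"
      by (rule sum.swap)
    also have "\<dots> = (\<Sum>j\<in>UNIV. Const (\<Sum>i\<in>UNIV. w (e i) $ j * v $ i) * L (X j))"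
      by (simp add: Const_sum sum_distrib_right)
    also have "\<dots> = hom_of L (w v)"
      by (simp add: hom_of_def W_expand[OF w, of v])
    finally show ?thesis ..
  qed
  with Der show ?B by blast
next
  assume B: ?B
  then have Der: "L \<in> Der" by simp
  have "act_Der w L = L" if w: "w \<in> W" for w
  proof
    fix p
    have "L (act w p) = act w (L p)" for p
    proof (induction p rule: cpoly_induct)
      case (X i)
      show ?case using B w by (metis Der_act_X hom_of_e)
    qed (simp_all add: Der_D[OF Der])
    then show "act_Der w L p = L p"
      by (simp add: act_Der_def w flip: \<open>\<And>p. L (act w p) = act w (L p)\<close>)
  qed
  with Der show ?A by (simp add: invariant_Der_def)
qed

definition vector_field :: "('n cpoly \<Rightarrow> 'n cpoly) \<Rightarrow> complex ^ 'n \<Rightarrow> complex ^ 'n::finite" where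
  "vector_field L x = (\<chi> i. eval (L (X i)) x)"

text \<open>Equivariance of \<open>hom_of L\<close> concerns a coefficient vector and an action on
  polynomials. Transposing by \<open>W_transpose\<close> moves it to the point \<open>x\<close>,
  where the hyperplane conditions live.\<close>

lemma vector_field_equivariant:
  assumes L: "L \<in> invariant_Der" and w: "w \<in> W"
  shows "vector_field L (w x) = w (vector_field L x)"
proof -
  have "vector_field L (w x) $ i = w (vector_field L x) $ i" for i
  proof -
    have "eval (L (X i)) (w x) = eval (act (inv w) (L (X i))) x"
      by (simp add: eval_act W_inv w W_inv_inv)
    also have "act (inv w) (L (X i)) = hom_of L (inv w (e i))"
      using L w W_inv by (metis hom_of_e invariant_Der_iff)
    also have "eval \<dots> x = (\<Sum>j\<in>UNIV. w (e j) $ i * eval (L (X j)) x)"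
      by (simp add: hom_of_def W_transpose[OF w])
    also have "\<dots> = w (vector_field L x) $ i"
      unfolding W_expand[OF w, of "vector_field L x" i] by (simp add: vector_field_def)
    finally show ?thesis by (simp add: vector_field_def)
  qed
  then show ?thesis by (simp add: vec_eq_iff)
qed

section \<open>Affine factors of the arrangement\<close>

definition affine_form :: "complex \<Rightarrow> ('n \<Rightarrow> complex) \<Rightarrow> 'n::finite cpoly" where
  "affine_form b a = Const b + (\<Sum>j\<in>UNIV. Const (a j) * X j)"

lemma eval_affine_form: "eval (affine_form b a) x = b + (\<Sum>j\<in>UNIV. a j * x $ j)"
  by (simp add: affine_form_def)

lemma eval_affine_form_shift:
  "eval (affine_form b a) (x + t *s e i) = eval (affine_form b a) x + a i * t"
proof -
  have "(\<Sum>j\<in>UNIV. a j * (x + t *s e i) $ j) = (\<Sum>j\<in>UNIV. a j * x $ j + (if j = i then a i * t else 0))"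
    by (intro sum.cong) (auto simp: axis_def algebra_simps)
  then show ?thesis by (simp add: eval_affine_form sum.distrib)
qed

lemma lookup_affine_form:
  "Poly_Mapping.lookup (affine_form b a) k =
    (b when 0 = k) + (\<Sum>j\<in>UNIV. a j when Poly_Mapping.single j 1 = k)"
  by (simp add: affine_form_def lookup_add lookup_sum Const_def X_def mult_single lookup_single)

lemma monomial_degree_1:
  fixes k :: "'n::finite \<Rightarrow>\<^sub>0 nat"
  assumes "(\<Sum>i\<in>UNIV. Poly_Mapping.lookup k i) = 1"
  obtains i where "k = Poly_Mapping.single i 1"
proof -
  obtain i where i: "Poly_Mapping.lookup k i = 1" "\<forall>j. j \<noteq> i \<longrightarrow> Poly_Mapping.lookup k j = 0"
    using assms unfolding sum_eq_1_iff[OF finite] by auto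
  then have "k = Poly_Mapping.single i 1"
    by (intro poly_mapping_eqI) (auto simp: lookup_single when_def)
  then show ?thesis by (rule that)
qed

lemma monomial_degree_0:
  fixes k :: "'n::finite \<Rightarrow>\<^sub>0 nat"
  assumes "(\<Sum>i\<in>UNIV. Poly_Mapping.lookup k i) = 0"
  shows "k = 0"
  using assms by (intro poly_mapping_eqI) simp

lemma single_1_neq_0: "Poly_Mapping.single j 1 \<noteq> (0 :: 'n \<Rightarrow>\<^sub>0 nat)"
  by (metis lookup_single_eq lookup_zero zero_neq_one)

lemma single_1_eq_iff: "Poly_Mapping.single i (1::nat) = Poly_Mapping.single j 1 \<longleftrightarrow> i = j"
  by (metis lookup_single_eq lookup_single_not_eq zero_neq_one)

lemma lookup_affine_form_other:
  assumes "0 \<noteq> k" "\<And>j. Poly_Mapping.single j 1 \<noteq> k"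
  shows "Poly_Mapping.lookup (affine_form b a) k = 0"
  unfolding lookup_affine_form using assms by (simp add: when_def del: One_nat_def)

lemma lookup_affine_form_0: "Poly_Mapping.lookup (affine_form b a) 0 = b"
  unfolding lookup_affine_form by (simp add: when_def single_1_neq_0 del: One_nat_def)

lemma lookup_affine_form_single: "Poly_Mapping.lookup (affine_form b a) (Poly_Mapping.single i 1) = a i"
proof -
  have "0 \<noteq> Poly_Mapping.single i (1::nat)" using single_1_neq_0[of i] by simp
  then show ?thesis
    unfolding lookup_affine_form by (simp add: when_def single_1_eq_iff del: One_nat_def)
qed

text \<open>Needed since \<open>D\<close> quantifies over arbitrary polynomials of
  \<open>total_degree\<close> one. The maximum bounds the degree of every monomial by 1, and it is
  attained, which gives the nonzero coefficient \<open>a i\<close>.\<close>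

lemma total_degree_1_E:
  fixes l :: "'n::finite cpoly"
  assumes "total_degree l = 1"
  obtains a b i where "l = affine_form b a" "a i \<noteq> 0"
proof -
  let ?d = "\<lambda>k :: 'n \<Rightarrow>\<^sub>0 nat. \<Sum>i\<in>UNIV. Poly_Mapping.lookup k i"
  have le: "?d k \<le> 1" if "k \<in> Poly_Mapping.keys l" for k
    using that assms unfolding total_degree_def by (metis Max_ge finite_imageI finite_insert finite_keys image_eqI insertCI)
  have "1 \<in> insert 0 (?d ` Poly_Mapping.keys l)"
    using assms unfolding total_degree_def by (metis Max_in empty_not_insert finite_imageI finite_insert finite_keys)
  then obtain k0 where k0: "k0 \<in> Poly_Mapping.keys l" "?d k0 = 1" by force
  obtain i where i: "k0 = Poly_Mapping.single i 1" using k0(2) by (rule monomial_degree_1)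
  define a where "a j = Poly_Mapping.lookup l (Poly_Mapping.single j 1)" for j
  have "l = affine_form (Poly_Mapping.lookup l 0) a"
  proof (rule poly_mapping_eqI)
    fix k
    consider "k = 0" | j where "k = Poly_Mapping.single j 1" | "?d k > 1"
      using monomial_degree_0[of k] monomial_degree_1[of k] by (metis One_nat_def less_one nat_neq_iff)
    then show "Poly_Mapping.lookup l k = Poly_Mapping.lookup (affine_form (Poly_Mapping.lookup l 0) a) k"
    proof cases
      case 1
      then show ?thesis
        by (simp add: lookup_affine_form_0)
    next
      case (2 j)
      then show ?thesis
        by (simp add: lookup_affine_form_single a_def del: One_nat_def)
    next
      case 3
      then have "Poly_Mapping.lookup l k = 0" using le[of k] by (force simp: in_keys_iff)
      moreover have "0 \<noteq> k" using 3 by auto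
      moreover have "Poly_Mapping.single j 1 \<noteq> k" for j
        using 3 by (auto simp: lookup_single when_def)
      ultimately show ?thesis by (simp add: lookup_affine_form_other del: One_nat_def)
    qed
  qed
  moreover have "a i \<noteq> 0" using k0 i by (simp add: a_def in_keys_iff)
  ultimately show ?thesis by (rule that)
qed

lemma total_degree_affine_form:
  assumes "a i \<noteq> 0"
  shows "total_degree (affine_form b a) = 1"
  unfolding total_degree_def
proof (rule Max_eqI)
  let ?d = "\<lambda>k :: 'a \<Rightarrow>\<^sub>0 nat. \<Sum>i\<in>UNIV. Poly_Mapping.lookup k i"
  have d1: "?d (Poly_Mapping.single j 1) = 1" for j by (simp add: lookup_single when_def)
  fix y assume "y \<in> insert 0 (?d ` Poly_Mapping.keys (affine_form b a))"
  then consider "y = 0" | k where "k \<in> Poly_Mapping.keys (affine_form b a)" "y = ?d k" by blast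
  then show "y \<le> 1"
  proof cases
    case 2
    have "k = 0 \<or> (\<exists>j. k = Poly_Mapping.single j 1)"
      using 2(1) lookup_affine_form_other[of k b a] by (metis in_keys_iff)
    then show ?thesis using 2(2) d1 by auto
  qed simp
next
  let ?d = "\<lambda>k :: 'a \<Rightarrow>\<^sub>0 nat. \<Sum>i\<in>UNIV. Poly_Mapping.lookup k i"
  have d1: "?d (Poly_Mapping.single i 1) = 1" by (simp add: lookup_single when_def)
  have "Poly_Mapping.single i 1 \<in> Poly_Mapping.keys (affine_form b a)"
    using assms by (simp add: in_keys_iff lookup_affine_form_single del: One_nat_def)
  then show "1 \<in> insert 0 (?d ` Poly_Mapping.keys (affine_form b a))"
    using d1 by (metis image_eqI insertCI)
qed simp

text \<open>Modulo an affine form involving \<open>X i\<close>, the variable \<open>X i\<close> can be eliminated; the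
  substitution below is the resulting retraction.\<close>

lemma eliminate:
  fixes a :: "'n::finite \<Rightarrow> complex" and b :: complex
  assumes "a i \<noteq> 0"
  defines "\<theta> \<equiv> X(i := X i - Const (inverse (a i)) * affine_form b a)"
  shows "affine_form b a dvd p - substitute Const \<theta> p"
    and "(\<And>x. eval (affine_form b a) x = 0 \<Longrightarrow> eval p x = 0) \<Longrightarrow> substitute Const \<theta> p = 0"
proof -
  let ?l = "affine_form b a"
  show "?l dvd p - substitute Const \<theta> p"
  proof (induction p rule: cpoly_induct)
    case (add p q)
    then have "?l dvd (p - substitute Const \<theta> p) + (q - substitute Const \<theta> q)" by (rule dvd_add)
    then show ?case by (simp add: Const_hom.substitute_add algebra_simps)
  next
    case (mult p q)
    then have "?l dvd (p - substitute Const \<theta> p) * q + substitute Const \<theta> p * (q - substitute Const \<theta> q)"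
      by (simp add: dvd_add)
    then show ?case by (simp add: Const_hom.substitute_mult algebra_simps)
  qed (auto simp: \<theta>_def)
  assume *: "\<And>x. eval ?l x = 0 \<Longrightarrow> eval p x = 0"
  show "substitute Const \<theta> p = 0"
  proof (rule eval_eq_0_imp)
    fix x
    \<comment> \<open>The projection of \<open>x\<close> to the hyperplane along \<open>e i\<close>;
      evaluating the substituted polynomial at \<open>x\<close> evaluates \<open>p\<close> at
      \<open>y\<close>.\<close>
    define y where "y = x + (- inverse (a i) * eval ?l x) *s e i"
    have "eval ?l y = 0"
      unfolding y_def eval_affine_form_shift using assms by simp
    moreover have "eval (substitute Const \<theta> p) x = eval p y"
      by (induction p rule: cpoly_induct)
        (auto simp: Const_hom.substitute_add Const_hom.substitute_mult \<theta>_def y_def axis_def)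
    ultimately show "eval (substitute Const \<theta> p) x = 0" using * by simp
  qed
qed

text \<open>A multiple of the form vanishes on its hyperplane. Conversely, a polynomial that
  vanishes there has image 0 under the retraction and is congruent to that image modulo the
  form.\<close>

lemma affine_form_dvd_iff:
  assumes "a i \<noteq> 0"
  shows "affine_form b a dvd p \<longleftrightarrow> (\<forall>x. eval (affine_form b a) x = 0 \<longrightarrow> eval p x = 0)"
  using eliminate[of a i b p, OF assms] by (auto elim!: dvdE)

lemma affine_form_nonzero: "a i \<noteq> 0 \<Longrightarrow> affine_form b a \<noteq> 0"
  using eval_affine_form_shift[of b a 0 1 i] by auto

text \<open>The form generates the kernel of the retraction, a ring homomorphism into a domain, so
  this kernel is a prime ideal. The sort \<open>linorder\<close> enters here: an order on the
  exponents excludes zero divisors.\<close>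

lemma prime_elem_affine_form:
  fixes a :: "'n::{finite,linorder} \<Rightarrow> complex"
  assumes "a i \<noteq> 0"
  shows "prime_elem (affine_form b a)"
proof (rule prime_elemI)
  let ?l = "affine_form b a"
  let ?\<pi> = "substitute Const (X(i := X i - Const (inverse (a i)) * ?l))"
  have iff: "?l dvd p \<longleftrightarrow> ?\<pi> p = 0" for p
    using eliminate[of a i b p, OF assms] by (auto elim!: dvdE)
  show "?l \<noteq> 0" using assms by (rule affine_form_nonzero)
  show "\<not> ?l dvd 1" by (simp add: iff)
  show "?l dvd p \<or> ?l dvd q" if "?l dvd p * q" for p q
    using that by (simp add: iff Const_hom.substitute_mult)
qed

lemma affine_form_dvd_affine_form:
  assumes "a i \<noteq> 0" "a' j \<noteq> 0" "affine_form b a dvd affine_form b' a'"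
  obtains c where "c \<noteq> 0" "affine_form b' a' = Const c * affine_form b a"
proof
  \<comment> \<open>In direction \<open>e i\<close> the forms have constant slopes
    \<open>a i\<close> and \<open>a' i\<close>. A step from \<open>x\<close> to the hyperplane of
    the first brings both to 0, so their values at \<open>x\<close> are in the ratio of the
    slopes.\<close>
  define c where "c = a' i / a i"
  let ?l = "affine_form b a" and ?l' = "affine_form b' a'"
  show eq: "?l' = Const c * ?l"
  proof (rule cpoly_eqI)
    fix x
    define t where "t = - eval ?l x / a i"
    have "eval ?l (x + t *s e i) = 0"
      unfolding eval_affine_form_shift using assms(1) by (simp add: t_def)
    then have "eval ?l' (x + t *s e i) = 0"
      using assms(3) by (auto elim!: dvdE)
    then show "eval ?l' x = eval (Const c * ?l) x"
      using assms(1) unfolding eval_affine_form_shift by (simp add: t_def c_def field_simps)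
  qed
  show "c \<noteq> 0" using eq affine_form_nonzero[of a' j b', OF assms(2)] by auto
qed

text \<open>A degree-one divisor \<open>l\<close> of \<open>P\<close> is prime, so it divides some
  \<open>f\<close> in \<open>S\<close>, and then \<open>f\<close> is a scalar multiple of
  \<open>l\<close>. Since \<open>L\<close> is linear, \<open>l\<close> inherits the divisibility
  from \<open>f\<close>.\<close>

lemma D_iff_factors:
  fixes P :: "'n::{finite,linorder} cpoly"
  assumes degree: "\<And>f. f \<in> S \<Longrightarrow> total_degree f = 1"
    and dvd: "\<And>f. f \<in> S \<Longrightarrow> f dvd P"
    and prime: "\<And>l. prime_elem l \<Longrightarrow> l dvd P \<Longrightarrow> \<exists>f\<in>S. l dvd f"
  shows "L \<in> D P \<longleftrightarrow> L \<in> Der \<and> (\<forall>f\<in>S. f dvd L f)"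
proof -
  have "l dvd L l" if H: "L \<in> Der" "\<forall>f\<in>S. f dvd L f" "total_degree l = 1" "l dvd P" for l
  proof -
    obtain a b i where l: "l = affine_form b a" "a i \<noteq> 0" using H(3) by (rule total_degree_1_E)
    then obtain f where f: "f \<in> S" "l dvd f" using prime prime_elem_affine_form H(4) by blast
    obtain a' b' j where f': "f = affine_form b' a'" "a' j \<noteq> 0"
      using degree[OF f(1)] by (rule total_degree_1_E)
    obtain c where c: "c \<noteq> 0" "f = Const c * l"
      using affine_form_dvd_affine_form[of a i a' j b b', OF l(2) f'(2)] f(2) l(1) f'(1) by metis
    have "l dvd L f" using f H(2) dvd_trans by blast
    then have "l dvd Const (inverse c) * (Const c * L l)"
      by (simp add: c(2) Der_D[OF H(1)])
    then show ?thesis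
      using c(1) by (simp flip: mult.assoc Const_mult)
  qed
  then show ?thesis using degree dvd by (auto simp: D_def)
qed

section \<open>The explicit linear factors of the arrangement\<close>

definition coords :: "nat \<Rightarrow> nat \<Rightarrow> complex set" where
  "coords m1 m2 = {0} \<union> (\<Union>s\<in>{1..m1}. {of_nat s, - of_nat s})
     \<union> (\<Union>s\<in>{1..m2}. {of_nat s - 1 / 2, - (of_nat s - 1 / 2)})"

definition shifts :: "nat \<Rightarrow> complex set" where
  "shifts m3 = {0} \<union> (\<Union>s\<in>{1..m3}. {of_nat s, - of_nat s})"

definition BCCat_factors :: "nat \<Rightarrow> nat \<Rightarrow> nat \<Rightarrow> 'n::{finite,linorder} cpoly set" where
  "BCCat_factors m1 m2 m3 = {X i - Const c | i c. c \<in> coords m1 m2}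
     \<union> {X i - Const \<epsilon> * X j - Const k | i j \<epsilon> k. i < j \<and> \<epsilon> \<in> {1, - 1} \<and> k \<in> shifts m3}"

lemma square_diff_factor:
  fixes Y :: "'n::finite cpoly"
  shows "Y\<^sup>2 - (of_nat k)\<^sup>2 = (Y - Const (of_nat k)) * (Y - Const (- of_nat k))"
  by (rule cpoly_eqI) (simp add: power2_eq_square algebra_simps)

text \<open>Exposes the hyperplanes \<open>x $ i = \<plusminus> (s - 1 / 2)\<close>. The leftover 4
  is a unit, which no prime divides.\<close>

lemma half_square_diff_factor:
  fixes Y :: "'n::finite cpoly"
  shows "4 * Y\<^sup>2 - (2 * of_nat k - 1)\<^sup>2 =
    (Y - Const (of_nat k - 1 / 2)) * (Const 4 * (Y - Const (- (of_nat k - 1 / 2))))"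
  by (rule cpoly_eqI) (simp add: power2_eq_square field_simps)

lemma prime_elem_dvd_prod:
  assumes "prime_elem p" "p dvd prod f A"
  shows "\<exists>a\<in>A. p dvd f a"
  using assms(2)
proof (induction A rule: infinite_finite_induct)
  case (insert a A)
  then show ?case using prime_elem_dvd_multD[OF assms(1)] by auto
qed (use assms(1) in \<open>auto simp: prime_elem_def\<close>)

lemma prime_elem_not_dvd_Const:
  assumes "prime_elem l" "c \<noteq> 0"
  shows "\<not> l dvd Const c"
proof
  assume "l dvd Const c"
  then have "l dvd Const c * Const (inverse c)" by simp
  then show False using assms by (simp add: prime_elem_def flip: Const_mult)
qed

lemma prime_dvd_BCCat:
  fixes l :: "'n::{finite,linorder} cpoly"
  assumes l: "prime_elem l" and "l dvd BCCat m1 m2 m3"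
  shows "\<exists>f\<in>BCCat_factors m1 m2 m3. l dvd f"
proof -
  note M = prime_elem_dvd_mult_iff[OF l] and P = prime_elem_dvd_prod[OF l]
  from assms(2) show ?thesis
    unfolding BCCat_def M
  proof
    assume "l dvd (\<Prod>i\<in>UNIV. X i * (\<Prod>j\<in>{1..m1}. (X i)\<^sup>2 - (of_nat j)\<^sup>2)
      * (\<Prod>j\<in>{1..m2}. 4 * (X i)\<^sup>2 - (2 * of_nat j - 1)\<^sup>2))"
    then obtain i where "l dvd X i * (\<Prod>j\<in>{1..m1}. (X i)\<^sup>2 - (of_nat j)\<^sup>2)
      * (\<Prod>j\<in>{1..m2}. 4 * (X i)\<^sup>2 - (2 * of_nat j - 1)\<^sup>2)"
      using P by blast
    then consider "l dvd X i" | s where "s \<in> {1..m1}" "l dvd (X i)\<^sup>2 - (of_nat s)\<^sup>2"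
      | s where "s \<in> {1..m2}" "l dvd 4 * (X i)\<^sup>2 - (2 * of_nat s - 1)\<^sup>2"
      unfolding M using P by blast
    then have "\<exists>c\<in>coords m1 m2. l dvd X i - Const c"
    proof cases
      case 1
      then show ?thesis by (intro bexI[of _ 0]) (simp_all add: coords_def)
    next
      case (2 s)
      then have "l dvd X i - Const (of_nat s) \<or> l dvd X i - Const (- of_nat s)"
        unfolding square_diff_factor M by blast
      moreover have "of_nat s \<in> coords m1 m2" "- of_nat s \<in> coords m1 m2"
        using 2(1) unfolding coords_def by blast+
      ultimately show ?thesis by blast
    next
      case (3 s)
      then have "l dvd X i - Const (of_nat s - 1 / 2) \<or> l dvd X i - Const (- (of_nat s - 1 / 2))"
        unfolding half_square_diff_factor M using prime_elem_not_dvd_Const[OF l, of 4] by auto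
      moreover have "of_nat s - 1 / 2 \<in> coords m1 m2" "- (of_nat s - 1 / 2) \<in> coords m1 m2"
        using 3(1) unfolding coords_def by blast+
      ultimately show ?thesis by blast
    qed
    then obtain c where c: "c \<in> coords m1 m2" "l dvd X i - Const c" by blast
    from c(1) have "X i - Const c \<in> BCCat_factors m1 m2 m3" unfolding BCCat_factors_def by blast
    from c(2) this show ?thesis by (rule bexI)
  next
    assume "l dvd (\<Prod>(i, j)\<in>{(i, j). i < j}. \<Prod>\<epsilon>\<in>{1, - 1}. (X i - \<epsilon> * X j)
      * (\<Prod>k\<in>{1..m3}. (X i - \<epsilon> * X j)\<^sup>2 - (of_nat k)\<^sup>2))"
    from P[OF this] obtain i j where ij: "i < j" "l dvd (\<Prod>\<epsilon>\<in>{1, - 1}. (X i - \<epsilon> * X j)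
      * (\<Prod>k\<in>{1..m3}. (X i - \<epsilon> * X j)\<^sup>2 - (of_nat k)\<^sup>2))"
      by (elim bexE) (simp only: split_paired_all mem_Collect_eq case_prod_conv)
    from P[OF ij(2)] obtain \<epsilon> where \<epsilon>: "\<epsilon> \<in> {1, - 1}" "l dvd (X i - \<epsilon> * X j)
      * (\<Prod>k\<in>{1..m3}. (X i - \<epsilon> * X j)\<^sup>2 - (of_nat k)\<^sup>2)"
      by (rule bexE)
    \<comment> \<open>In \<open>BCCat\<close> the sign is a polynomial; in
      \<open>BCCat_factors\<close> it is a complex number under \<open>Const\<close>.\<close>
    from \<epsilon>(1) have "\<exists>\<delta>\<in>{1, - 1}. \<epsilon> = Const \<delta>"
      by (auto simp: Const_uminus)
    then obtain \<delta> where \<delta>: "\<delta> \<in> {1, - 1}" "\<epsilon> = Const \<delta>"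
      by (rule bexE)
    consider "l dvd X i - Const \<delta> * X j"
      | s where "s \<in> {1..m3}" "l dvd (X i - Const \<delta> * X j)\<^sup>2 - (of_nat s)\<^sup>2"
      using \<epsilon>(2)[unfolded M \<delta>(2)] P by blast
    then have "\<exists>k\<in>shifts m3. l dvd X i - Const \<delta> * X j - Const k"
    proof cases
      case 1
      then show ?thesis by (intro bexI[of _ 0]) (simp_all add: shifts_def)
    next
      case (2 s)
      then have "l dvd X i - Const \<delta> * X j - Const (of_nat s)
        \<or> l dvd X i - Const \<delta> * X j - Const (- of_nat s)"
        unfolding square_diff_factor M by blast
      moreover have "of_nat s \<in> shifts m3" "- of_nat s \<in> shifts m3"
        using 2(1) unfolding shifts_def by blast+
      ultimately show ?thesis by blast
    qed
    then obtain k where k: "k \<in> shifts m3" "l dvd X i - Const \<delta> * X j - Const k" by blast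
    from k(1) ij(1) \<delta>(1) have "X i - Const \<delta> * X j - Const k \<in> BCCat_factors m1 m2 m3"
      unfolding BCCat_factors_def by blast
    from k(2) this show ?thesis by (rule bexI)
  qed
qed

lemma factor_dvd_BCCat:
  assumes "f \<in> BCCat_factors m1 m2 m3"
  shows "f dvd BCCat m1 m2 m3"
  using assms unfolding BCCat_factors_def
proof (elim UnE CollectE exE conjE)
  fix i c assume f: "f = X i - Const c" and c: "c \<in> coords m1 m2"
  let ?A = "\<Prod>s\<in>{1..m1}. (X i)\<^sup>2 - (of_nat s)\<^sup>2"
  let ?B = "\<Prod>s\<in>{1..m2}. 4 * (X i)\<^sup>2 - (2 * of_nat s - 1)\<^sup>2"
  consider "c = 0" | s where "s \<in> {1..m1}" "c = of_nat s \<or> c = - of_nat s"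
    | s where "s \<in> {1..m2}" "c = of_nat s - 1 / 2 \<or> c = - (of_nat s - 1 / 2)"
    using c unfolding coords_def by blast
  then have "f dvd X i * ?A * ?B"
  proof cases
    case 1
    then show ?thesis by (simp add: f mult.assoc)
  next
    case (2 s)
    then have "f dvd (X i)\<^sup>2 - (of_nat s)\<^sup>2" unfolding square_diff_factor f by auto
    also have "\<dots> dvd ?A" using 2 by (intro dvd_prodI) auto
    finally show ?thesis by (simp add: dvd_mult dvd_mult2)
  next
    case (3 s)
    then have "f dvd 4 * (X i)\<^sup>2 - (2 * of_nat s - 1)\<^sup>2" unfolding half_square_diff_factor f by auto
    also have "\<dots> dvd ?B" using 3 by (intro dvd_prodI) auto
    finally show ?thesis by (simp add: dvd_mult)
  qed
  also have "\<dots> dvd (\<Prod>i\<in>UNIV. X i * (\<Prod>s\<in>{1..m1}. (X i)\<^sup>2 - (of_nat s)\<^sup>2)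
    * (\<Prod>s\<in>{1..m2}. 4 * (X i)\<^sup>2 - (2 * of_nat s - 1)\<^sup>2))"
    by (rule dvd_prodI) auto
  finally show ?thesis unfolding BCCat_def by (rule dvd_mult2)
next
  fix i j \<delta> k assume f: "f = X i - Const \<delta> * X j - Const k" and ij: "i < j"
    and \<delta>: "\<delta> \<in> {1, - 1}" and k: "k \<in> shifts m3"
  let ?F = "\<lambda>i j \<epsilon>. (X i - \<epsilon> * X j) * (\<Prod>k\<in>{1..m3}. (X i - \<epsilon> * X j)\<^sup>2 - (of_nat k)\<^sup>2)"
  consider "k = 0" | s where "s \<in> {1..m3}" "k = of_nat s \<or> k = - of_nat s"
    using k unfolding shifts_def by blast
  then have "f dvd ?F i j (Const \<delta>)"
  proof cases
    case 1
    then show ?thesis by (simp add: f)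
  next
    case (2 s)
    then have "f dvd (X i - Const \<delta> * X j)\<^sup>2 - (of_nat s)\<^sup>2" unfolding square_diff_factor f by auto
    also have "\<dots> dvd (\<Prod>k\<in>{1..m3}. (X i - Const \<delta> * X j)\<^sup>2 - (of_nat k)\<^sup>2)"
      using 2 by (intro dvd_prodI) auto
    finally show ?thesis by (rule dvd_mult)
  qed
  also have "?F i j (Const \<delta>) dvd (\<Prod>\<epsilon>\<in>{1, - 1}. ?F i j \<epsilon>)"
    using \<delta> by (intro dvd_prodI) (auto simp: Const_uminus)
  also have "\<dots> dvd (\<Prod>(i, j)\<in>{(i, j). i < j}. \<Prod>\<epsilon>\<in>{1, - 1}. ?F i j \<epsilon>)"
    using dvd_prodI[of "{(i, j). i < j}" "(i, j)" "\<lambda>(i, j). \<Prod>\<epsilon>\<in>{1, - 1}. ?F i j \<epsilon>"] ij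
    by simp
  finally show ?thesis unfolding BCCat_def by (rule dvd_mult)
qed

lemma factors_affine_form:
  "X i - Const c = affine_form (- c) (\<lambda>j. if j = i then 1 else 0)"
  "i \<noteq> j \<Longrightarrow> X i - Const \<delta> * X j - Const k =
    affine_form (- k) (\<lambda>l. if l = i then 1 else if l = j then - \<delta> else 0)"
proof -
  show "X i - Const c = affine_form (- c) (\<lambda>j. if j = i then 1 else 0)"
    by (rule cpoly_eqI) (simp add: eval_affine_form if_distrib[of "\<lambda>c. c * _"] cong: if_cong)
  assume "i \<noteq> j"
  then have "(\<Sum>l\<in>UNIV. (if l = i then 1 else if l = j then - \<delta> else 0) * x $ l) =
    (\<Sum>l\<in>UNIV. (if l = i then x $ i else 0) + (if l = j then - \<delta> * x $ j else 0))" for x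
    by (intro sum.cong) auto
  then show "X i - Const \<delta> * X j - Const k =
    affine_form (- k) (\<lambda>l. if l = i then 1 else if l = j then - \<delta> else 0)"
    by (intro cpoly_eqI) (simp add: eval_affine_form sum.distrib)
qed

text \<open>\<open>L\<close> kills constants, so the shift disappears from \<open>L f\<close> and
  survives only in the hyperplane on which \<open>L f\<close> must vanish.\<close>

lemma D_BCCat_iff:
  fixes L :: "'n::{finite,linorder} cpoly \<Rightarrow> 'n cpoly"
  assumes L: "L \<in> Der"
  shows "L \<in> D (BCCat m1 m2 m3) \<longleftrightarrow>
    (\<forall>i. \<forall>c\<in>coords m1 m2. \<forall>x. x $ i = c \<longrightarrow> vector_field L x $ i = 0) \<and>
    (\<forall>i j. i < j \<longrightarrow> (\<forall>\<epsilon>\<in>{1, - 1}. \<forall>k\<in>shifts m3. \<forall>x. x $ i - \<epsilon> * x $ j = k \<longrightarrow>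
       vector_field L x $ i = \<epsilon> * vector_field L x $ j))"
proof -
  have coord: "X i - Const c dvd L (X i - Const c) \<longleftrightarrow>
    (\<forall>x. x $ i = c \<longrightarrow> vector_field L x $ i = 0)" for i c
    unfolding factors_affine_form
    by (subst affine_form_dvd_iff[of _ i], simp)
      (simp add: Der_diff[OF L] Der_D[OF L] vector_field_def flip: factors_affine_form)
  have root: "X i - Const \<epsilon> * X j - Const k dvd L (X i - Const \<epsilon> * X j - Const k) \<longleftrightarrow>
    (\<forall>x. x $ i - \<epsilon> * x $ j = k \<longrightarrow> vector_field L x $ i = \<epsilon> * vector_field L x $ j)"
    if "i < j" for i j \<epsilon> k
  proof -
    have ij: "i \<noteq> j" using that by simp
    show ?thesis
      unfolding factors_affine_form(2)[OF ij]
      by (subst affine_form_dvd_iff[of _ i], simp)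
        (simp add: Der_diff[OF L] Der_D[OF L] vector_field_def flip: factors_affine_form(2)[OF ij])
  qed
  have degree: "total_degree f = 1" if "f \<in> BCCat_factors m1 m2 m3" for f :: "'n cpoly"
    using that unfolding BCCat_factors_def
  proof (elim UnE CollectE exE conjE)
    fix i c assume "f = X i - Const c"
    then show ?thesis
      using total_degree_affine_form[of "\<lambda>j. if j = i then 1 else 0" i] by (simp add: factors_affine_form)
  next
    fix i j \<delta> k assume f: "f = X i - Const \<delta> * X j - Const k" and "i < j"
    then have ij: "i \<noteq> j" by simp
    show ?thesis
      unfolding f factors_affine_form(2)[OF ij] by (rule total_degree_affine_form[of _ i]) simp
  qed
  have "L \<in> D (BCCat m1 m2 m3) \<longleftrightarrow> L \<in> Der \<and> (\<forall>f\<in>BCCat_factors m1 m2 m3. f dvd L f)"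
    by (rule D_iff_factors[OF degree factor_dvd_BCCat prime_dvd_BCCat])
  also have "\<dots> \<longleftrightarrow> (\<forall>i. \<forall>c\<in>coords m1 m2. X i - Const c dvd L (X i - Const c)) \<and>
    (\<forall>i j. i < j \<longrightarrow> (\<forall>\<epsilon>\<in>{1, - 1}. \<forall>k\<in>shifts m3.
      X i - Const \<epsilon> * X j - Const k dvd L (X i - Const \<epsilon> * X j - Const k)))"
    unfolding BCCat_factors_def using L by blast
  finally show ?thesis by (simp only: coord root cong: imp_cong)
qed

section \<open>Divisibility and quasi-invariance\<close>

definition flip :: "'n \<Rightarrow> complex ^ 'n \<Rightarrow> complex ^ 'n::finite" where
  "flip j x = (\<chi> i. (if i = j then - 1 else 1) * x $ i)"

text \<open>For \<open>a \<noteq> b\<close>, the reflection in the root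
  \<open>e a - \<epsilon> *s e b\<close>, for both signs at once.\<close>

definition swap :: "'n \<Rightarrow> 'n \<Rightarrow> complex \<Rightarrow> complex ^ 'n \<Rightarrow> complex ^ 'n::finite" where
  "swap a b \<epsilon> x = (\<chi> i. (if i = a \<or> i = b then \<epsilon> else 1) * x $ Transposition.transpose a b i)"

lemma flip_W: "flip j \<in> W"
  unfolding flip_def[abs_def] using W_I[of id "\<lambda>i. if i = j then - 1 else 1"] by simp

lemma swap_W: "\<epsilon> \<in> {1, - 1} \<Longrightarrow> swap a b \<epsilon> \<in> W"
  unfolding swap_def[abs_def] by (rule W_I) auto

lemma flip_shift: "x $ j = 0 \<Longrightarrow> flip j (x + t *s e j) = x - t *s e j"
  by (auto simp: flip_def vec_eq_iff axis_def)

text \<open>\<open>x\<close> lies on the mirror and is fixed. The two displacements in the third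
  condition of \<open>Q_tr\<close> are mirror images because
  \<open>\<epsilon> * \<epsilon> = 1\<close>.\<close>

lemma swap_shift:
  assumes "\<epsilon> \<in> {1, - 1}" "a \<noteq> b" "x $ b = \<epsilon> * x $ a"
  shows "swap a b \<epsilon> (x + (\<epsilon> * t) *s e a) = x + t *s e b"
proof -
  have "swap a b \<epsilon> (x + (\<epsilon> * t) *s e a) $ i = (x + t *s e b) $ i" for i
    using assms by (cases "i = a"; cases "i = b") (auto simp: swap_def axis_def algebra_simps)
  then show ?thesis by (simp add: vec_eq_iff)
qed

text \<open>Both sides of the equivalence are conditions on an equivariant vector field \<open>f\<close>. A
  quasi-invariance condition on \<open>f x $ i\<close> holds by equivariance unless the reflection in question
  moves \<open>x $ i\<close>; otherwise it compares \<open>f x $ i\<close> with \<open>\<plusminus> f x $ j\<close> on a shifted hyperplane.\<close>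

context
  fixes f :: "complex ^ 'n::finite \<Rightarrow> complex ^ 'n"
  assumes equivariant: "\<And>w x. w \<in> W \<Longrightarrow> f (w x) = w (f x)"
begin

lemma field_flip: "f (flip j x) $ i = (if i = j then - f x $ i else f x $ i)"
  using equivariant[OF flip_W[of j]] by (simp add: flip_def)

lemma field_swap:
  assumes "\<epsilon> \<in> {1, - 1}" "a \<noteq> b"
  shows "f (swap a b \<epsilon> x) $ a = \<epsilon> * f x $ b" "f (swap a b \<epsilon> x) $ b = \<epsilon> * f x $ a"
    "i \<noteq> a \<Longrightarrow> i \<noteq> b \<Longrightarrow> f (swap a b \<epsilon> x) $ i = f x $ i"
  using assms equivariant[OF swap_W[of \<epsilon> a b]] by (simp_all add: swap_def)

lemma coordinate_condition_iff:
  "(\<forall>i j x. x $ j = 0 \<longrightarrow> f (x + t *s e j) $ i = f (x - t *s e j) $ i) \<longleftrightarrow>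
    (\<forall>i x. x $ i = t \<or> x $ i = - t \<longrightarrow> f x $ i = 0)" (is "?Q \<longleftrightarrow> ?D")
proof
  assume Q: ?Q
  \<comment> \<open>The hypothesis makes the two values equal and \<open>flip i\<close> makes them
    opposite; hence both are 0.\<close>
  have *: "f (y + t *s e i) $ i = 0 \<and> f (y - t *s e i) $ i = 0" if "y $ i = 0" for y i
  proof -
    have "f (y + t *s e i) $ i = f (y - t *s e i) $ i" using Q that by blast
    moreover have "f (y - t *s e i) $ i = - f (y + t *s e i) $ i"
      using field_flip[of i "y + t *s e i" i] by (simp add: flip_shift[OF that])
    ultimately show ?thesis by simp
  qed
  show ?D
  proof (intro allI impI)
    fix i and x :: "complex ^ 'n" assume "x $ i = t \<or> x $ i = - t"
    then show "f x $ i = 0"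
      using *[of "x - t *s e i" i] *[of "x + t *s e i" i] by auto
  qed
next
  assume D: ?D
  show ?Q
  proof (intro allI impI)
    fix i j and x :: "complex ^ 'n" assume x: "x $ j = 0"
    have "f (x - t *s e j) $ i = f (flip j (x + t *s e j)) $ i" by (simp add: flip_shift x)
    moreover have "f (x + t *s e j) $ j = 0" using D x by simp
    ultimately show "f (x + t *s e j) $ i = f (x - t *s e j) $ i"
      by (simp add: field_flip)
  qed
qed

text \<open>\<open>flip i\<close> fixes the points of this hyperplane and negates component
  \<open>i\<close>; this accounts for the central factor \<open>X i\<close>.\<close>

lemma coordinate_condition_0: "x $ i = 0 \<Longrightarrow> f x $ i = 0"
  using field_flip[of i x i] flip_shift[of x i 0] by simp

text \<open>Multiplying the equation by \<open>- \<epsilon>\<close> exchanges \<open>a\<close> and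
  \<open>b\<close> and sends \<open>k\<close> to \<open>- (\<epsilon> * k)\<close>. As
  \<open>shifts\<close> is closed under negation, the arrangement, which lists only
  \<open>i < j\<close>, controls all ordered pairs.\<close>

lemma root_condition_sym:
  assumes "\<And>x. x $ a - \<epsilon> * x $ b = k \<Longrightarrow> f x $ a = \<epsilon> * f x $ b" "\<epsilon> \<in> {1, - 1}"
    and "x $ b - \<epsilon> * x $ a = - (\<epsilon> * k)"
  shows "f x $ b = \<epsilon> * f x $ a"
proof -
  have "x $ a - \<epsilon> * x $ b = k" using assms(2,3) by (auto simp: algebra_simps)
  then show ?thesis using assms(1)[of x] assms(2) by auto
qed

lemma root_condition_iff:
  "(\<forall>i a b. a \<noteq> b \<longrightarrow> (\<forall>\<epsilon>\<in>{1, - 1}. \<forall>x. x $ b = \<epsilon> * x $ a \<longrightarrow>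
      f (x + (\<epsilon> * t) *s e a) $ i = f (x + t *s e b) $ i)) \<longleftrightarrow>
    (\<forall>a b. a \<noteq> b \<longrightarrow> (\<forall>\<epsilon>\<in>{1, - 1}. \<forall>x. x $ a - \<epsilon> * x $ b = t \<or> x $ a - \<epsilon> * x $ b = - t \<longrightarrow>
      f x $ a = \<epsilon> * f x $ b))" (is "?Q \<longleftrightarrow> ?D")
proof
  assume Q: ?Q
  \<comment> \<open>Here \<open>x\<close> is the first compared point. The second is its image under
    \<open>swap a b \<epsilon>\<close>, and equivariance turns component \<open>a\<close> there into
    \<open>\<epsilon>\<close> times component \<open>b\<close> at \<open>x\<close>.\<close>
  have *: "f x $ a = \<epsilon> * f x $ b" if "a \<noteq> b" "\<epsilon> \<in> {1, - 1}" "x $ a - \<epsilon> * x $ b = \<epsilon> * t" for a b \<epsilon> x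
  proof -
    define y where "y = x - (\<epsilon> * t) *s e a"
    have y: "y $ b = \<epsilon> * y $ a" using that by (auto simp: y_def axis_def algebra_simps)
    have x: "x = y + (\<epsilon> * t) *s e a" by (simp add: y_def)
    have "f x $ a = f (y + t *s e b) $ a" using Q that(1,2) y unfolding x by blast
    also have "\<dots> = f (swap a b \<epsilon> x) $ a" unfolding x by (simp add: swap_shift[OF that(2,1) y])
    also have "\<dots> = \<epsilon> * f x $ b" by (rule field_swap[OF that(2,1)])
    finally show ?thesis .
  qed
  \<comment> \<open>Now \<open>x\<close> is the second compared point, which yields the shift
    \<open>t\<close> itself rather than \<open>\<epsilon> * t\<close>.\<close>
  have **: "f x $ b = \<epsilon> * f x $ a" if "a \<noteq> b" "\<epsilon> \<in> {1, - 1}" "x $ b - \<epsilon> * x $ a = t" for a b \<epsilon> x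
  proof -
    define y where "y = x - t *s e b"
    have y: "y $ b = \<epsilon> * y $ a" using that by (auto simp: y_def axis_def algebra_simps)
    have x: "x = y + t *s e b" by (simp add: y_def)
    define z where "z = y + (\<epsilon> * t) *s e a"
    have xz: "x = swap a b \<epsilon> z" unfolding x z_def by (simp add: swap_shift[OF that(2,1) y])
    have "f x $ b = f z $ b" "f x $ a = f z $ a" using Q that(1,2) y unfolding x z_def by metis+
    moreover have "f x $ b = \<epsilon> * f z $ a" unfolding xz by (rule field_swap[OF that(2,1)])
    ultimately show ?thesis by simp
  qed
  show ?D
  proof (intro allI impI ballI)
    fix a b \<epsilon> and x :: "complex ^ 'n" assume ab: "(a :: 'n) \<noteq> b" and \<epsilon>: "\<epsilon> \<in> {1, - 1 :: complex}"
      and x: "x $ a - \<epsilon> * x $ b = t \<or> x $ a - \<epsilon> * x $ b = - t"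
    \<comment> \<open>\<open>**\<close> with \<open>a\<close> and \<open>b\<close> exchanged gives
      the shift \<open>t\<close>, and \<open>*\<close> gives \<open>\<epsilon> * t\<close>. For
      \<open>\<epsilon> = - 1\<close> these are \<open>t\<close> and \<open>- t\<close>; for
      \<open>\<epsilon> = 1\<close> the shift \<open>- t\<close> is left, and exchanging
      \<open>a\<close> and \<open>b\<close> in \<open>*\<close> supplies it.\<close>
    consider "\<epsilon> = 1" "x $ a - \<epsilon> * x $ b = - t" | "x $ a - \<epsilon> * x $ b = t" | "x $ a - \<epsilon> * x $ b = \<epsilon> * t"
      using x \<epsilon> by auto
    then show "f x $ a = \<epsilon> * f x $ b"
    proof cases
      case 1
      then show ?thesis using *[of b a \<epsilon> x] ab by (simp add: algebra_simps)
    next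
      case 2
      then show ?thesis using **[of b a \<epsilon> x] ab \<epsilon> by simp
    next
      case 3
      then show ?thesis using *[of a b \<epsilon> x] ab \<epsilon> by simp
    qed
  qed
next
  assume D: ?D
  show ?Q
  proof (intro allI impI ballI)
    fix i a b \<epsilon> and x :: "complex ^ 'n" assume ab: "(a :: 'n) \<noteq> b" and \<epsilon>: "\<epsilon> \<in> {1, - 1 :: complex}"
      and x: "x $ b = \<epsilon> * x $ a"
    define z where "z = x + (\<epsilon> * t) *s e a"
    have "z $ a - \<epsilon> * z $ b = \<epsilon> * t" using \<epsilon> x ab by (auto simp: z_def axis_def)
    then have "z $ a - \<epsilon> * z $ b = t \<or> z $ a - \<epsilon> * z $ b = - t" using \<epsilon> by auto
    then have z: "f z $ a = \<epsilon> * f z $ b" using D ab \<epsilon> by blast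
    \<comment> \<open>Components other than \<open>a\<close> and \<open>b\<close> are untouched by
      the reflection, and the relation just obtained makes the two exchanged ones agree.\<close>
    have "f (swap a b \<epsilon> z) $ i = f z $ i"
      using z field_swap[OF \<epsilon> ab] \<epsilon> by (cases "i = a"; cases "i = b") auto
    then show "f (x + (\<epsilon> * t) *s e a) $ i = f (x + t *s e b) $ i"
      using swap_shift[OF \<epsilon> ab x] by (simp add: z_def)
  qed
qed

lemma root_condition_0:
  assumes "a \<noteq> b" "\<epsilon> \<in> {1, - 1}" "x $ a - \<epsilon> * x $ b = 0"
  shows "f x $ a = \<epsilon> * f x $ b"
proof -
  have "x $ b = \<epsilon> * x $ a" using assms by auto
  then have "swap a b \<epsilon> x = x" using swap_shift[OF assms(2,1), of x 0] by simp
  then show ?thesis using field_swap(1)[OF assms(2,1), of x] by simp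
qed

end

lemma ball_coords:
  "(\<forall>c\<in>coords m1 m2. P c) \<longleftrightarrow> P 0 \<and> (\<forall>s\<in>{1..m1}. P (of_nat s) \<and> P (- of_nat s))
     \<and> (\<forall>s\<in>{1..m2}. P (of_nat s - 1 / 2) \<and> P (- (of_nat s - 1 / 2)))"
  by (simp add: coords_def ball_Un)

lemma ball_shifts:
  "(\<forall>k\<in>shifts m3. P k) \<longleftrightarrow> P 0 \<and> (\<forall>s\<in>{1..m3}. P (of_nat s) \<and> P (- of_nat s))"
  by (simp add: shifts_def ball_Un)

text \<open>Both sides become conditions on one equivariant field. What remains is to regroup
  quantifiers, to add the automatic shift 0, and to pass between \<open>a \<noteq> b\<close> and
  \<open>a < b\<close>.\<close>

lemma D_BCCat_iff_Q_tr:
  fixes L :: "'n::{finite,linorder} cpoly \<Rightarrow> 'n cpoly"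
  assumes L: "L \<in> invariant_Der"
  shows "L \<in> D (BCCat m1 m2 m3) \<longleftrightarrow> (\<forall>i. L (X i) \<in> Q_tr m1 m2 m3)"
proof -
  let ?f = "vector_field L"
  note eq = vector_field_equivariant[OF L]
  note C = coordinate_condition_iff[of ?f, OF eq]
  note R = root_condition_iff[of ?f, OF eq]
  have ev: "eval (L (X i)) x = ?f x $ i" for i x by (simp add: vector_field_def)
  have "(\<forall>i. L (X i) \<in> Q_tr m1 m2 m3) \<longleftrightarrow>
    (\<forall>s\<in>{1..m1}. \<forall>i j x. x $ j = 0 \<longrightarrow> ?f (x + of_nat s *s e j) $ i = ?f (x - of_nat s *s e j) $ i) \<and>
    (\<forall>s\<in>{1..m2}. \<forall>i j x. x $ j = 0 \<longrightarrow>
      ?f (x + (of_nat s - 1 / 2) *s e j) $ i = ?f (x - (of_nat s - 1 / 2) *s e j) $ i) \<and>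
    (\<forall>s\<in>{1..m3}. \<forall>i a b. a \<noteq> b \<longrightarrow> (\<forall>\<epsilon>\<in>{1, - 1}. \<forall>x. x $ b = \<epsilon> * x $ a \<longrightarrow>
      ?f (x + (\<epsilon> * of_nat s) *s e a) $ i = ?f (x + of_nat s *s e b) $ i))"
  proof -
    \<comment> \<open>With the conditions replaced by free predicates, the regrouping is pure
      predicate logic.\<close>
    have reorder: "(\<forall>i. (\<forall>j. \<forall>s\<in>A. \<forall>x. P s i j x) \<and> (\<forall>j. \<forall>s\<in>B. \<forall>x. Q s i j x) \<and>
        (\<forall>a b. N a b \<longrightarrow> (\<forall>s\<in>C. \<forall>\<epsilon>\<in>E. \<forall>x. R s i a b \<epsilon> x))) \<longleftrightarrow>
      (\<forall>s\<in>A. \<forall>i j x. P s i j x) \<and> (\<forall>s\<in>B. \<forall>i j x. Q s i j x) \<and>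
        (\<forall>s\<in>C. \<forall>i a b. N a b \<longrightarrow> (\<forall>\<epsilon>\<in>E. \<forall>x. R s i a b \<epsilon> x))"
      for A B C :: "nat set" and N :: "'n \<Rightarrow> 'n \<Rightarrow> bool" and E :: "complex set" and P Q :: "nat \<Rightarrow> 'n \<Rightarrow> 'n \<Rightarrow> (complex, 'n) vec \<Rightarrow> bool"
        and R :: "nat \<Rightarrow> 'n \<Rightarrow> 'n \<Rightarrow> 'n \<Rightarrow> complex \<Rightarrow> (complex, 'n) vec \<Rightarrow> bool"
      by blast
    show ?thesis unfolding Q_tr_def mem_Collect_eq ev by (rule reorder)
  qed
  also have "\<dots> \<longleftrightarrow>
    (\<forall>s\<in>{1..m1}. \<forall>i x. x $ i = of_nat s \<or> x $ i = - of_nat s \<longrightarrow> ?f x $ i = 0) \<and>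
    (\<forall>s\<in>{1..m2}. \<forall>i x. x $ i = of_nat s - 1 / 2 \<or> x $ i = - (of_nat s - 1 / 2) \<longrightarrow> ?f x $ i = 0) \<and>
    (\<forall>s\<in>{1..m3}. \<forall>a b. a \<noteq> b \<longrightarrow> (\<forall>\<epsilon>\<in>{1, - 1}. \<forall>x.
      x $ a - \<epsilon> * x $ b = of_nat s \<or> x $ a - \<epsilon> * x $ b = - of_nat s \<longrightarrow> ?f x $ a = \<epsilon> * ?f x $ b))"
    by (simp only: C R)
  also have "\<dots> \<longleftrightarrow>
    (\<forall>i. \<forall>c\<in>coords m1 m2. \<forall>x. x $ i = c \<longrightarrow> ?f x $ i = 0) \<and>
    (\<forall>a b. a \<noteq> b \<longrightarrow> (\<forall>\<epsilon>\<in>{1, - 1}. \<forall>k\<in>shifts m3. \<forall>x. x $ a - \<epsilon> * x $ b = k \<longrightarrow>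
      ?f x $ a = \<epsilon> * ?f x $ b))"
  proof -
    define \<Phi> where "\<Phi> i c \<longleftrightarrow> (\<forall>x. x $ i = c \<longrightarrow> ?f x $ i = 0)" for i c
    define \<Psi> where "\<Psi> a b \<epsilon> k \<longleftrightarrow> (\<forall>x. x $ a - \<epsilon> * x $ b = k \<longrightarrow> ?f x $ a = \<epsilon> * ?f x $ b)" for a b \<epsilon> k
    have \<Phi>2: "(\<forall>x. x $ i = t \<or> x $ i = u \<longrightarrow> ?f x $ i = 0) \<longleftrightarrow> \<Phi> i t \<and> \<Phi> i u" for i t u
      unfolding \<Phi>_def by (simp only: imp_disjL all_conj_distrib)
    have \<Psi>2: "(\<forall>x. x $ a - \<epsilon> * x $ b = t \<or> x $ a - \<epsilon> * x $ b = u \<longrightarrow> ?f x $ a = \<epsilon> * ?f x $ b)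
      \<longleftrightarrow> \<Psi> a b \<epsilon> t \<and> \<Psi> a b \<epsilon> u" for a b \<epsilon> t u
      unfolding \<Psi>_def by (simp only: imp_disjL all_conj_distrib)
    have \<Phi>0: "\<Phi> i 0" for i
      unfolding \<Phi>_def using coordinate_condition_0[of ?f, OF eq] by simp
    have \<Psi>0: "\<Psi> a b \<epsilon> 0" if "a \<noteq> b" "\<epsilon> \<in> {1, - 1}" for a b \<epsilon>
      unfolding \<Psi>_def using root_condition_0[of ?f, OF eq that] by simp
    have reorder: "(\<forall>s\<in>A. \<forall>i. \<Phi> i (g s) \<and> \<Phi> i (- g s)) \<and> (\<forall>s\<in>B. \<forall>i. \<Phi> i (h s) \<and> \<Phi> i (- h s)) \<and>
        (\<forall>s\<in>C. \<forall>a b. N a b \<longrightarrow> (\<forall>\<epsilon>\<in>E. \<Psi> a b \<epsilon> (g s) \<and> \<Psi> a b \<epsilon> (- g s))) \<longleftrightarrow>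
      (\<forall>i. \<Phi> i 0 \<and> (\<forall>s\<in>A. \<Phi> i (g s) \<and> \<Phi> i (- g s)) \<and> (\<forall>s\<in>B. \<Phi> i (h s) \<and> \<Phi> i (- h s))) \<and>
        (\<forall>a b. N a b \<longrightarrow> (\<forall>\<epsilon>\<in>E. \<Psi> a b \<epsilon> 0 \<and> (\<forall>s\<in>C. \<Psi> a b \<epsilon> (g s) \<and> \<Psi> a b \<epsilon> (- g s))))"
      if "\<And>i. \<Phi> i 0" "\<And>a b \<epsilon>. N a b \<Longrightarrow> \<epsilon> \<in> E \<Longrightarrow> \<Psi> a b \<epsilon> 0"
      for A B C :: "nat set" and N E and g h :: "nat \<Rightarrow> complex"
      using that by blast
    show ?thesis
      unfolding \<Phi>2 \<Psi>2 \<Phi>_def[symmetric] \<Psi>_def[symmetric] ball_coords ball_shifts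
      by (rule reorder) (rule \<Phi>0, rule \<Psi>0)
  qed
  also have "\<dots> \<longleftrightarrow>
    (\<forall>i. \<forall>c\<in>coords m1 m2. \<forall>x. x $ i = c \<longrightarrow> ?f x $ i = 0) \<and>
    (\<forall>a b. a < b \<longrightarrow> (\<forall>\<epsilon>\<in>{1, - 1}. \<forall>k\<in>shifts m3. \<forall>x. x $ a - \<epsilon> * x $ b = k \<longrightarrow>
      ?f x $ a = \<epsilon> * ?f x $ b))" (is "?C \<and> ?R \<longleftrightarrow> ?C \<and> ?R'")
  proof -
    have "?R" if R': "?R'"
    proof (intro allI impI ballI)
      fix a b \<epsilon> k x
      assume ab: "(a :: 'n) \<noteq> b" and \<epsilon>: "\<epsilon> \<in> {1, - 1 :: complex}" and k: "k \<in> shifts m3"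
        and x: "x $ a - \<epsilon> * x $ b = k"
      have k': "- (\<epsilon> * k) \<in> shifts m3" using k \<epsilon> by (auto simp: shifts_def)
      show "?f x $ a = \<epsilon> * ?f x $ b"
      proof (cases "a < b")
        case True
        then show ?thesis using R' \<epsilon> k x by blast
      next
        case False
        then have "b < a" using ab by simp
        show ?thesis
        proof (rule root_condition_sym[of ?f, OF eq _ \<epsilon>])
          show "?f y $ b = \<epsilon> * ?f y $ a" if "y $ b - \<epsilon> * y $ a = - (\<epsilon> * k)" for y
            using R' \<open>b < a\<close> \<epsilon> k' that by blast
          show "x $ a - \<epsilon> * x $ b = - (\<epsilon> * - (\<epsilon> * k))" using x \<epsilon> by auto
        qed
      qed
    qed
    moreover have "?R'" if R: "?R"
    proof (intro allI impI)
      fix a b :: 'n assume "a < b"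
      then show "\<forall>\<epsilon>\<in>{1, - 1}. \<forall>k\<in>shifts m3. \<forall>x. x $ a - \<epsilon> * x $ b = k \<longrightarrow> ?f x $ a = \<epsilon> * ?f x $ b"
        by (intro R[THEN spec, THEN spec, THEN mp]) simp
    qed
    ultimately show ?thesis by (intro conj_cong refl iffI)
  qed
  also have "\<dots> \<longleftrightarrow> L \<in> D (BCCat m1 m2 m3)"
    using L by (intro D_BCCat_iff[symmetric]) (simp add: invariant_Der_def)
  finally show ?thesis ..
qed

section \<open>Equivariant maps into the quasi-invariants\<close>

lemma Q_tr_add: "p \<in> Q_tr m1 m2 m3 \<Longrightarrow> q \<in> Q_tr m1 m2 m3 \<Longrightarrow> p + q \<in> Q_tr m1 m2 m3"
  by (simp add: Q_tr_def)

lemma Q_tr_0: "0 \<in> Q_tr m1 m2 m3"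
  by (simp add: Q_tr_def)

lemma invariants_eval:
  assumes "f \<in> invariants" "w \<in> W"
  shows "eval f (w x) = eval f x"
proof -
  have "act (inv w) f = f" using assms by (simp add: invariants_def W_inv)
  then show ?thesis using eval_act[OF W_inv[OF assms(2)], of f x] assms(2) by (simp add: W_inv_inv)
qed

lemma Const_invariants: "Const c \<in> invariants"
  by (simp add: invariants_def)

text \<open>The two points compared by each condition lie in one \<open>W\<close>-orbit, where
  \<open>f\<close> is constant.\<close>

lemma Q_tr_mult:
  fixes f p :: "'n::finite cpoly"
  assumes f: "f \<in> invariants" and p: "p \<in> Q_tr m1 m2 m3"
  shows "f * p \<in> Q_tr m1 m2 m3"
proof -
  have 1: "eval f (x + t *s e j) = eval f (x - t *s e j)" if "x $ j = 0" for x j t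
    using invariants_eval[OF f flip_W, of j "x + t *s e j"] by (simp add: flip_shift that)
  have 2: "eval f (x + (\<epsilon> * t) *s e i) = eval f (x + t *s e j)"
    if "i \<noteq> j" "\<epsilon> \<in> {1, - 1}" "x $ j = \<epsilon> * x $ i" for x i j \<epsilon> t
    using invariants_eval[OF f swap_W[OF that(2)], of i j "x + (\<epsilon> * t) *s e i"]
    by (simp add: swap_shift[OF that(2,1,3)])
  show ?thesis
    unfolding Q_tr_def mem_Collect_eq
  proof (intro conjI allI ballI impI)
    fix j s and x :: "(complex, 'n) vec" assume "s \<in> {1..m1}" and x: "x $ j = 0"
    then show "eval (f * p) (x + of_nat s *s e j) = eval (f * p) (x - of_nat s *s e j)"
      using p 1[OF x] by (simp add: Q_tr_def)
  next
    fix j s and x :: "(complex, 'n) vec" assume "s \<in> {1..m2}" and x: "x $ j = 0"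
    then have "eval p (x + (of_nat s - 1 / 2) *s e j) = eval p (x - (of_nat s - 1 / 2) *s e j)"
      using p unfolding Q_tr_def by blast
    then show "eval (f * p) (x + (of_nat s - 1 / 2) *s e j) = eval (f * p) (x - (of_nat s - 1 / 2) *s e j)"
      by (simp only: eval_simps 1[OF x])
  next
    fix i j s \<epsilon> and x :: "(complex, 'n) vec" assume "i \<noteq> j" "s \<in> {1..m3}" "\<epsilon> \<in> {1, - 1}" "x $ j = \<epsilon> * x $ i"
    then have "eval p (x + (\<epsilon> * of_nat s) *s e i) = eval p (x + of_nat s *s e j)"
      using p unfolding Q_tr_def by blast
    then show "eval (f * p) (x + (\<epsilon> * of_nat s) *s e i) = eval (f * p) (x + of_nat s *s e j)"
      using 2[OF \<open>i \<noteq> j\<close> \<open>\<epsilon> \<in> {1, - 1}\<close> \<open>x $ j = \<epsilon> * x $ i\<close>] by simp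
  qed
qed

lemma hom_of_in_Q_tr:
  assumes "\<And>i. L (X i) \<in> Q_tr m1 m2 m3"
  shows "hom_of L v \<in> Q_tr m1 m2 m3"
proof -
  have "(\<Sum>i\<in>I. Const (v $ i) * L (X i)) \<in> Q_tr m1 m2 m3" for I
    by (induction I rule: infinite_finite_induct)
      (simp_all add: Q_tr_0 Q_tr_add Q_tr_mult Const_invariants assms)
  then show ?thesis by (simp add: hom_of_def)
qed

lemma D_W_BCCat_iff:
  fixes L :: "'n::{finite,linorder} cpoly \<Rightarrow> 'n cpoly"
  shows "L \<in> D_W (BCCat m1 m2 m3) \<longleftrightarrow> L \<in> invariant_Der \<and> (\<forall>v. hom_of L v \<in> Q_tr m1 m2 m3)"
  using D_BCCat_iff_Q_tr[of L m1 m2 m3] hom_of_in_Q_tr[of L m1 m2 m3] hom_of_e[of L]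
  unfolding D_W_eq by (metis Int_iff)

lemma D_W_BCCat_iff_Hom:
  fixes L :: "'n::{finite,linorder} cpoly \<Rightarrow> 'n cpoly"
  shows "L \<in> D_W (BCCat m1 m2 m3) \<longleftrightarrow> L \<in> Der \<and> hom_of L \<in> Hom_W_V (Q_tr m1 m2 m3)"
  by (auto simp: D_W_BCCat_iff invariant_Der_iff Hom_W_V_def linear_hom_of)

lemma hom_of_eq_D:
  assumes "L \<in> Der" "L' \<in> Der" "hom_of L = hom_of L'"
  shows "L = L'"
  using assms(1,2) by (rule Der_eqI) (metis assms(3) hom_of_e)

text \<open>Injective because a derivation is determined on the variables; surjective because any
  values on the variables extend, by \<open>derivation\<close>. The inverse will be the second
  isomorphism of the theorem.\<close>

lemma bij_betw_hom_of:
  "bij_betw hom_of (D_W (BCCat m1 m2 m3 :: 'n::{finite,linorder} cpoly)) (Hom_W_V (Q_tr m1 m2 m3))"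
  unfolding bij_betw_def
proof
  show "inj_on hom_of (D_W (BCCat m1 m2 m3 :: 'n cpoly))"
    by (rule inj_onI) (auto simp: D_W_BCCat_iff_Hom intro: hom_of_eq_D)
  show "hom_of ` D_W (BCCat m1 m2 m3 :: 'n cpoly) = Hom_W_V (Q_tr m1 m2 m3)"
  proof (intro equalityI subsetI)
    fix \<phi> :: "(complex, 'n) vec \<Rightarrow> 'n cpoly" assume \<phi>: "\<phi> \<in> Hom_W_V (Q_tr m1 m2 m3)"
    let ?L = "derivation (\<lambda>i. \<phi> (e i))"
    have "hom_of ?L = \<phi>"
      using \<phi> by (intro hom_of_unique) (simp_all add: Hom_W_V_def)
    then show "\<phi> \<in> hom_of ` D_W (BCCat m1 m2 m3)"
      using \<phi> by (intro image_eqI[of _ _ ?L]) (simp_all add: D_W_BCCat_iff_Hom derivation_Der)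
  qed (auto simp: D_W_BCCat_iff_Hom)
qed

lemma Der_0_in: "0 \<in> Der"
  by (simp add: Der_iff)

lemma D_W_0: "0 \<in> D_W (BCCat m1 m2 m3)"
  by (simp add: D_W_BCCat_iff invariant_Der_iff Der_0_in hom_of_def Q_tr_0)

lemma D_W_add:
  assumes "L \<in> D_W (BCCat m1 m2 m3)" "L' \<in> D_W (BCCat m1 m2 m3)"
  shows "L + L' \<in> D_W (BCCat m1 m2 m3)"
proof -
  have "L \<in> Der" "L' \<in> Der" using assms by (simp_all add: D_W_BCCat_iff_Hom)
  then have "L + L' \<in> Der"
    unfolding Der_iff[of "L + L'"] by (simp add: Der_D algebra_simps)
  then show ?thesis
    using assms by (simp add: D_W_BCCat_iff invariant_Der_iff hom_of_add_left Q_tr_add)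
qed

lemma D_W_scale:
  assumes "f \<in> invariants" "L \<in> D_W (BCCat m1 m2 m3)"
  shows "scale_Der f L \<in> D_W (BCCat m1 m2 m3)"
proof -
  have "L \<in> Der" using assms by (simp add: D_W_BCCat_iff_Hom)
  then have "scale_Der f L \<in> Der"
    unfolding Der_iff[of "scale_Der f L"] by (simp add: Der_D scale_Der_def algebra_simps)
  moreover have "act w f = f" if "w \<in> W" for w using that assms(1) by (simp add: invariants_def)
  ultimately show ?thesis
    using assms by (simp add: D_W_BCCat_iff invariant_Der_iff hom_of_scale_Der Q_tr_mult)
qed

lemma hom_of_equivariant:
  "L \<in> invariant_Der \<Longrightarrow> w \<in> W \<Longrightarrow> hom_of L (w v) = act w (hom_of L v)"
  by (simp add: invariant_Der_iff)

text \<open>\<open>v - flip j v\<close> is \<open>(2 * v $ j) *s e j\<close>, so equivariance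
  isolates one component.\<close>

lemma invariant_Der_flip:
  assumes "L \<in> invariant_Der"
  shows "hom_of L v - act (flip j) (hom_of L v) = Const (2 * v $ j) * L (X j)"
proof -
  have "flip j v = v + (- 2 * v $ j) *s e j"
    by (auto simp: flip_def vec_eq_iff axis_def)
  then have "hom_of L (flip j v) = hom_of L v + Const (- 2 * v $ j) * L (X j)"
    by (simp only: hom_of_add hom_of_scale hom_of_e)
  moreover have "act (flip j) (hom_of L v) = hom_of L (flip j v)"
    using hom_of_equivariant[OF assms flip_W] by simp
  ultimately show ?thesis by (simp add: Const_uminus)
qed

lemma Const_mult_eq_0_D:
  assumes "Const c * p = 0" "c \<noteq> 0"
  shows "p = 0"
proof -
  have "p = Const (inverse c) * (Const c * p)"
    using assms(2) by (simp flip: mult.assoc Const_mult)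
  then show ?thesis by (simp add: assms(1))
qed

text \<open>A Schur argument by hand: a sign change extracts the component at a nonzero coordinate
  of \<open>v\<close>, and transpositions carry its vanishing to all variables.\<close>

lemma hom_of_irreducible:
  assumes L: "L \<in> invariant_Der" and "hom_of L v = 0" "v \<noteq> 0"
  shows "L = 0"
proof (rule Der_eqI[OF _ Der_0_in])
  show "L \<in> Der" using L by (simp add: invariant_Der_def)
  fix i
  obtain j where j: "v $ j \<noteq> 0" using \<open>v \<noteq> 0\<close> by (auto simp: vec_eq_iff)
  have "L (X j) = 0"
    using invariant_Der_flip[OF L, of v j] Const_mult_eq_0_D[of "2 * v $ j" "L (X j)"] assms(2) j by simp
  then have "act (swap i j 1) (hom_of L (e j)) = 0" by simp
  moreover have "swap i j 1 (e j) = e i"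
    by (auto simp: swap_def vec_eq_iff axis_def Transposition.transpose_def)
  ultimately show "L (X i) = 0 (X i)"
    using hom_of_equivariant[OF L swap_W[of 1 i j], of "e j"] by simp
qed

text \<open>Subtract from the sum its image under \<open>flip j\<close>: the summands with
  \<open>i \<noteq> j\<close> are fixed and cancel, and twice the summand of \<open>j\<close>
  remains. This will give the injectivity of the map from tensors to polynomials.\<close>

lemma components_independent:
  assumes T: "\<And>i. T i \<in> invariant_Der" and "(\<Sum>i\<in>UNIV. T i (X i)) = 0"
  shows "T j = 0"
proof -
  have "0 = (\<Sum>i\<in>UNIV. T i (X i)) - act (flip j) (\<Sum>i\<in>UNIV. T i (X i))"
    using assms(2) by simp
  also have "\<dots> = (\<Sum>i\<in>UNIV. hom_of (T i) (e i) - act (flip j) (hom_of (T i) (e i)))"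
    by (simp add: act_sum sum_subtractf)
  also have "\<dots> = (\<Sum>i\<in>UNIV. if i = j then Const 2 * T j (X j) else 0)"
    by (intro sum.cong refl) (auto simp only: invariant_Der_flip[OF T], auto simp: axis_def)
  also have "\<dots> = Const 2 * T j (X j)" by simp
  finally have "Const 2 * T j (X j) = 0" by (rule sym)
  then have "T j (X j) = 0" by (rule Const_mult_eq_0_D) simp
  then show ?thesis using hom_of_irreducible[OF T, of j "e j"] by (simp add: axis_eq_0_iff)
qed

lemma invariant_copy_of_V:
  fixes L :: "'n::{finite,linorder} cpoly \<Rightarrow> 'n cpoly"
  assumes L: "L \<in> D_W (BCCat m1 m2 m3)" and "L \<noteq> 0"
  shows "range (hom_of L) \<in> copies_of_V_in (Q_tr m1 m2 m3)"
proof -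
  have inv: "L \<in> invariant_Der" and Q: "hom_of L v \<in> Q_tr m1 m2 m3" for v
    using L by (simp_all add: D_W_BCCat_iff)
  have eq: "hom_of L (w v) = act w (hom_of L v)" if "w \<in> W" for w v
    using inv that by (simp add: invariant_Der_iff)
  have "inj (hom_of L)"
  proof (rule injI)
    fix v v' assume "hom_of L v = hom_of L v'"
    then have "hom_of L (v + (- 1) *s v') = 0"
      by (simp only: hom_of_add hom_of_scale) (simp add: Const_uminus)
    then show "v = v'" using hom_of_irreducible[OF inv] \<open>L \<noteq> 0\<close> by force
  qed
  then have "bij_betw (hom_of L) UNIV (range (hom_of L))" by (rule inj_on_imp_bij_betw)
  moreover have "cpoly.subspace (range (hom_of L))"
    unfolding cpoly.subspace_def
  proof (intro conjI allI ballI)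
    show "0 \<in> range (hom_of L)" by (rule image_eqI[of _ _ 0]) (simp_all add: hom_of_def)
    show "p + q \<in> range (hom_of L)" if "p \<in> range (hom_of L)" "q \<in> range (hom_of L)" for p q
      using that by (auto simp flip: hom_of_add)
    show "cscale c p \<in> range (hom_of L)" if "p \<in> range (hom_of L)" for c p
      using that by (auto simp: cscale_def simp flip: hom_of_scale)
  qed
  moreover have "act w ` range (hom_of L) \<subseteq> range (hom_of L)" if "w \<in> W" for w
    by (auto simp flip: eq[OF that])
  ultimately show ?thesis
    unfolding copies_of_V_in_def using Q eq linear_hom_of[of L] by blast
qed

section \<open>Tensor products with \<open>V\<close>\<close>

interpretation free: module "\<lambda>c. Poly_Mapping.map ((*) c) :: ('k \<Rightarrow>\<^sub>0 complex) \<Rightarrow> 'k \<Rightarrow>\<^sub>0 complex"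
proof -
  have "Poly_Mapping.lookup (Poly_Mapping.map ((*) c) t) k = c * Poly_Mapping.lookup t k"
    for c and t :: "'k \<Rightarrow>\<^sub>0 complex" and k
    by (simp add: map.rep_eq when_def)
  then show "module (\<lambda>c. Poly_Mapping.map ((*) c) :: ('k \<Rightarrow>\<^sub>0 complex) \<Rightarrow> 'k \<Rightarrow>\<^sub>0 complex)"
    by unfold_locales (auto intro!: poly_mapping_eqI simp: lookup_add algebra_simps)
qed

text \<open>The linear extension of \<open>hom_of\<close> to the free space. It is defined before
  passing to the quotient, so that classes can be compared through polynomials.\<close>

definition realize ::
    "(('n cpoly \<Rightarrow> 'n cpoly) \<times> (complex ^ 'n) \<Rightarrow>\<^sub>0 complex) \<Rightarrow> 'n::finite cpoly" where
  "realize t = (\<Sum>(L, v)\<in>Poly_Mapping.keys t. Const (Poly_Mapping.lookup t (L, v)) * hom_of L v)"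

lemma realize_superset:
  assumes "finite K" "Poly_Mapping.keys t \<subseteq> K"
  shows "realize t = (\<Sum>(L, v)\<in>K. Const (Poly_Mapping.lookup t (L, v)) * hom_of L v)"
  unfolding realize_def by (rule sum.mono_neutral_left[OF assms]) (auto simp: in_keys_iff)

lemma realize_add: "realize (s + t) = realize s + realize t"
proof -
  let ?K = "Poly_Mapping.keys s \<union> Poly_Mapping.keys t"
  have "Poly_Mapping.keys (s + t) \<subseteq> ?K" by (rule keys_add)
  then show ?thesis
    by (simp add: realize_superset[of ?K] lookup_add Const_add distrib_right sum.distrib case_prod_beta)
qed

lemma realize_single [simp]: "realize (Poly_Mapping.single (L, v) c) = Const c * hom_of L v"
  by (simp add: realize_superset[of "{(L, v)}"])

lemma realize_0 [simp]: "realize 0 = 0"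
  by (simp add: realize_def)

lemma realize_diff: "realize (s - t) = realize s - realize t"
  using realize_add[of "s - t" t] by simp

lemma realize_sum: "realize (sum f A) = (\<Sum>a\<in>A. realize (f a))"
  by (induction A rule: infinite_finite_induct) (simp_all add: realize_add)

lemma realize_map: "realize (Poly_Mapping.map ((*) c) t) = Const c * realize t"
proof (induction t rule: poly_mapping_single_induct)
  case (single k d)
  then show ?case by (cases k) (simp add: Const_mult mult.assoc)
qed (simp add: free.scale_right_distrib realize_add distrib_left)

lemma tensor_free_single: "L \<in> A \<Longrightarrow> v \<in> B \<Longrightarrow> Poly_Mapping.single (L, v) c \<in> tensor_free A B"
  by (simp add: tensor_free_def)

lemma tensor_free_add: "s \<in> tensor_free A B \<Longrightarrow> t \<in> tensor_free A B \<Longrightarrow> s + t \<in> tensor_free A B"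
  using keys_add[of s t] by (auto simp: tensor_free_def)

lemma tensor_free_0: "0 \<in> tensor_free A B"
  by (simp add: tensor_free_def)

lemma tensor_free_sum: "(\<And>a. a \<in> I \<Longrightarrow> f a \<in> tensor_free A B) \<Longrightarrow> sum f I \<in> tensor_free A B"
  by (induction I rule: infinite_finite_induct) (simp_all add: tensor_free_0 tensor_free_add)

lemma tensor_free_induct [consumes 1, case_names zero single add]:
  assumes "t \<in> tensor_free A B" and "P 0"
    and "\<And>a b c. a \<in> A \<Longrightarrow> b \<in> B \<Longrightarrow> P (Poly_Mapping.single (a, b) c)"
    and "\<And>s t. P s \<Longrightarrow> P t \<Longrightarrow> P (s + t)"
  shows "P t"
proof -
  have "P (\<Sum>k\<in>K. Poly_Mapping.single k (Poly_Mapping.lookup t k))"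
    if "K \<subseteq> Poly_Mapping.keys t" for K
    using that
  proof (induction K rule: infinite_finite_induct)
    case (insert k K)
    then have "k \<in> A \<times> B" using assms(1) by (auto simp: tensor_free_def)
    then show ?case using insert assms(3,4) by auto
  qed (simp_all add: assms(2))
  from this[OF subset_refl] show ?thesis by (simp add: poly_mapping_sum_single)
qed

text \<open>The tensor calculus takes from \<open>D_W P\<close> only that it is a complex subspace;
  independence of the components enters as a hypothesis of \<open>realize_imp_equiv\<close>.\<close>

locale tensor_with_V =
  fixes A :: "('n::finite cpoly \<Rightarrow> 'n cpoly) set"
  assumes zero_in: "0 \<in> A" and add_in: "L \<in> A \<Longrightarrow> L' \<in> A \<Longrightarrow> L + L' \<in> A"
    and scale_in: "L \<in> A \<Longrightarrow> scale_Der (Const c) L \<in> A"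
begin

abbreviation relations where
  "relations \<equiv> free.span (bilinearity_relations (\<lambda>c. scale_Der (Const c)) (*s) A UNIV)"

abbreviation \<delta> where
  "\<delta> L v \<equiv> Poly_Mapping.single (L, v :: complex ^ 'n) (1 :: complex)"

definition tensor_equiv (infix \<open>\<cong>\<close> 50) where
  "s \<cong> t \<longleftrightarrow> s - t \<in> relations"

lemma equiv_refl [simp]: "t \<cong> t"
  by (simp add: tensor_equiv_def free.span_zero)

lemma equiv_sym: "s \<cong> t \<Longrightarrow> t \<cong> s"
  unfolding tensor_equiv_def using free.span_neg by fastforce

lemma equiv_trans [trans]: "s \<cong> t \<Longrightarrow> t \<cong> u \<Longrightarrow> s \<cong> u"
  unfolding tensor_equiv_def using free.span_add by fastforce

lemma equiv_add: "s \<cong> t \<Longrightarrow> s' \<cong> t' \<Longrightarrow> s + s' \<cong> t + t'"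
  unfolding tensor_equiv_def using free.span_add by (fastforce simp: algebra_simps)

lemma equiv_sum: "(\<And>i. i \<in> I \<Longrightarrow> f i \<cong> g i) \<Longrightarrow> sum f I \<cong> sum g I"
  by (induction I rule: infinite_finite_induct) (simp_all add: equiv_add)

lemma equiv_add_left: "L \<in> A \<Longrightarrow> L' \<in> A \<Longrightarrow> \<delta> (L + L') v \<cong> \<delta> L v + \<delta> L' v"
  unfolding tensor_equiv_def diff_diff_eq[symmetric]
  by (rule free.span_base) (unfold bilinearity_relations_def Let_def, blast)

lemma equiv_add_right: "L \<in> A \<Longrightarrow> \<delta> L (v + v') \<cong> \<delta> L v + \<delta> L v'"
  unfolding tensor_equiv_def diff_diff_eq[symmetric]
  by (rule free.span_base) (unfold bilinearity_relations_def Let_def, blast)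

lemma equiv_scale_left: "L \<in> A \<Longrightarrow> \<delta> (scale_Der (Const c) L) v \<cong> Poly_Mapping.single (L, v) c"
  unfolding tensor_equiv_def
  by (rule free.span_base) (unfold bilinearity_relations_def Let_def, blast)

lemma equiv_scale_right: "L \<in> A \<Longrightarrow> \<delta> L (c *s v) \<cong> Poly_Mapping.single (L, v) c"
  unfolding tensor_equiv_def
  by (rule free.span_base) (unfold bilinearity_relations_def Let_def, blast)

lemma equiv_zero_right: "L \<in> A \<Longrightarrow> \<delta> L 0 \<cong> 0"
  using equiv_scale_right[of L 0 0] by simp

lemma equiv_zero_left: "\<delta> 0 v \<cong> 0"
proof -
  have "scale_Der (Const 0) 0 = (0 :: 'n cpoly \<Rightarrow> 'n cpoly)" by (simp add: scale_Der_def fun_eq_iff)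
  then show ?thesis using equiv_scale_left[OF zero_in, of 0 v] by simp
qed

lemma equiv_sum_right:
  assumes "L \<in> A"
  shows "\<delta> L (\<Sum>i\<in>I. v i) \<cong> (\<Sum>i\<in>I. \<delta> L (v i))"
proof (induction I rule: infinite_finite_induct)
  case (insert i I)
  then show ?case
    using equiv_trans[OF equiv_add_right[OF assms] equiv_add[OF equiv_refl insert.IH]] by simp
qed (simp_all add: equiv_zero_right assms)

lemma equiv_zero_components: "(\<Sum>i\<in>UNIV. \<delta> 0 (e i)) \<cong> 0"
proof -
  have "(\<Sum>i\<in>UNIV. \<delta> 0 (e i)) \<cong> (\<Sum>i\<in>(UNIV :: 'n set). 0)"
    by (intro equiv_sum equiv_zero_left)
  then show ?thesis by simp
qed

text \<open>Since the \<open>e i\<close> span \<open>V\<close>, a pure tensor splits along them, and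
  the coordinates of \<open>v\<close> move to the left factor; the left factors are then collected
  for each \<open>e i\<close>.\<close>

lemma equiv_components:
  assumes "t \<in> tensor_free A UNIV"
  shows "\<exists>T. (\<forall>i. T i \<in> A) \<and> t \<cong> (\<Sum>i\<in>UNIV. \<delta> (T i) (e i))"
  using assms
proof (induction t rule: tensor_free_induct)
  case zero
  show ?case
    by (rule exI[of _ "\<lambda>_. 0"]) (use zero_in equiv_sym[OF equiv_zero_components] in blast)
next
  case (single L v c)
  let ?cL = "scale_Der (Const c) L"
  have cL: "?cL \<in> A" using single(1) by (rule scale_in)
  have "Poly_Mapping.single (L, v) c \<cong> \<delta> ?cL v"
    by (rule equiv_sym[OF equiv_scale_left[OF single(1)]])
  also have "\<delta> ?cL v = \<delta> ?cL (\<Sum>i\<in>UNIV. v $ i *s e i)"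
    by (simp add: basis_expansion)
  also have "\<dots> \<cong> (\<Sum>i\<in>UNIV. \<delta> ?cL (v $ i *s e i))"
    by (rule equiv_sum_right[OF cL])
  also have "\<dots> \<cong> (\<Sum>i\<in>UNIV. \<delta> (scale_Der (Const (v $ i)) ?cL) (e i))"
    by (intro equiv_sum equiv_trans[OF equiv_scale_right[OF cL] equiv_sym[OF equiv_scale_left[OF cL]]])
  finally show ?case
    using cL by (intro exI[of _ "\<lambda>i. scale_Der (Const (v $ i)) ?cL"]) (simp add: scale_in)
next
  case (add s t)
  then obtain S T where S: "\<And>i. S i \<in> A" "s \<cong> (\<Sum>i\<in>UNIV. \<delta> (S i) (e i))"
    and T: "\<And>i. T i \<in> A" "t \<cong> (\<Sum>i\<in>UNIV. \<delta> (T i) (e i))" by blast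
  have "s + t \<cong> (\<Sum>i\<in>UNIV. \<delta> (S i) (e i) + \<delta> (T i) (e i))"
    unfolding sum.distrib by (rule equiv_add[OF S(2) T(2)])
  also have "\<dots> \<cong> (\<Sum>i\<in>UNIV. \<delta> (S i + T i) (e i))"
    by (intro equiv_sum equiv_sym[OF equiv_add_left] S T)
  finally show ?case
    by (rule exI[of _ "\<lambda>i. S i + T i", OF conjI, rotated]) (use S T add_in in blast)
qed

lemma equiv_imp_realize:
  assumes "s \<cong> t"
  shows "realize s = realize t"
proof -
  have "realize u = 0" if "u \<in> relations" for u
    using that
  proof (induction rule: free.span_induct_alt)
    case (step c x y)
    have "realize x = 0"
      using step(1) unfolding bilinearity_relations_def Let_def
      by (auto simp: realize_diff hom_of_add_left hom_of_add hom_of_scale hom_of_scale_Der)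
    then show ?case by (simp add: realize_add realize_map step)
  qed simp
  then have "realize (s - t) = 0" using assms unfolding tensor_equiv_def by blast
  then show ?thesis by (simp add: realize_diff)
qed

text \<open>In the normal form of \<open>s - t\<close> the components sum to
  \<open>realize (s - t)\<close>, which is 0, so independence makes each of them 0.\<close>

lemma realize_imp_equiv:
  assumes independent: "\<And>T. (\<And>i. T i \<in> A) \<Longrightarrow> (\<Sum>i\<in>UNIV. T i (X i)) = 0 \<Longrightarrow> (\<forall>i. T i = 0)"
    and st: "s \<in> tensor_free A UNIV" "t \<in> tensor_free A UNIV" "realize s = realize t"
  shows "s \<cong> t"
proof -
  have keys: "Poly_Mapping.keys (s - t) \<subseteq> Poly_Mapping.keys s \<union> Poly_Mapping.keys t"
    by (auto simp: in_keys_iff lookup_minus)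
  then have "s - t \<in> tensor_free A UNIV" using st by (auto simp: tensor_free_def)
  then obtain T where T: "\<And>i. T i \<in> A" "s - t \<cong> (\<Sum>i\<in>UNIV. \<delta> (T i) (e i))"
    using equiv_components by blast
  have "(\<Sum>i\<in>UNIV. T i (X i)) = realize (s - t)"
    unfolding equiv_imp_realize[OF T(2)] by (simp add: realize_sum)
  also have "\<dots> = 0" by (simp add: realize_diff st(3))
  finally have T0: "T i = 0" for i using independent[of T] T(1) by blast
  have "s - t \<cong> 0"
    using equiv_trans[OF T(2)[unfolded T0] equiv_zero_components] .
  then show ?thesis by (simp add: tensor_equiv_def)
qed

end

section \<open>The isomorphisms\<close>

interpretation D_W: tensor_with_V "D_W (BCCat m1 m2 m3 :: 'n::{finite,linorder} cpoly)" for m1 m2 m3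
  by unfold_locales (simp_all add: D_W_0 D_W_add D_W_scale Const_invariants)

lemma tensor_rel_iff:
  fixes m1 m2 m3 :: nat
  defines "A \<equiv> D_W (BCCat m1 m2 m3 :: 'n::{finite,linorder} cpoly)"
  shows "(s, t) \<in> tensor_rel (\<lambda>c. scale_Der (Const c)) (*s) A UNIV \<longleftrightarrow>
    s \<in> tensor_free A UNIV \<and> t \<in> tensor_free A UNIV \<and> realize s = realize t"
proof -
  have "T i = 0" if "\<And>i. T i \<in> A" "(\<Sum>i\<in>UNIV. T i (X i)) = 0" for T i
    using that by (intro components_independent) (auto simp: A_def D_W_BCCat_iff)
  then show ?thesis
    using D_W.realize_imp_equiv[of m1 m2 m3 s t] D_W.equiv_imp_realize[of m1 m2 m3 s t]
    unfolding tensor_rel_def D_W.tensor_equiv_def A_def by blast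
qed

text \<open>An equivariant parametrization of a copy of \<open>V\<close> is some
  \<open>hom_of L\<close>, so the copy consists of realized pure tensors. Conversely, each nonzero
  \<open>L\<close> gives a copy of \<open>V\<close> by \<open>invariant_copy_of_V\<close>.\<close>

lemma Q_tr_V_eq_realize:
  "Q_tr_V m1 m2 m3 = realize ` tensor_free (D_W (BCCat m1 m2 m3 :: 'n::{finite,linorder} cpoly)) UNIV"
  (is "_ = realize ` ?F")
proof
  have "cpoly.subspace (realize ` ?F)"
    unfolding cpoly.subspace_def
  proof (intro conjI allI ballI)
    show "0 \<in> realize ` ?F" by (rule image_eqI[of _ _ 0]) (simp_all add: tensor_free_0)
    show "p + q \<in> realize ` ?F" if "p \<in> realize ` ?F" "q \<in> realize ` ?F" for p q
      using that by (auto simp: tensor_free_add simp flip: realize_add)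
    show "cscale c p \<in> realize ` ?F" if p: "p \<in> realize ` ?F" for c p
    proof -
      obtain t where t: "t \<in> ?F" "p = realize t" using p by blast
      have "Poly_Mapping.keys (Poly_Mapping.map ((*) c) t) \<subseteq> Poly_Mapping.keys t"
        by (auto simp: in_keys_iff map.rep_eq when_def)
      then have "Poly_Mapping.map ((*) c) t \<in> ?F" using t(1) by (auto simp: tensor_free_def)
      then show ?thesis by (auto simp: t(2) cscale_def simp flip: realize_map)
    qed
  qed
  moreover have "U \<subseteq> realize ` ?F" if U: "U \<in> copies_of_V_in (Q_tr m1 m2 m3)" for U
  proof
    fix p assume "p \<in> U"
    from U obtain \<phi> :: "(complex, 'n) vec \<Rightarrow> 'n cpoly" where \<phi>: "U \<subseteq> Q_tr m1 m2 m3"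
      "Vector_Spaces.linear (*s) cscale \<phi>" "bij_betw \<phi> UNIV U" "\<forall>w\<in>W. \<forall>v. \<phi> (w v) = act w (\<phi> v)"
      unfolding copies_of_V_in_def by blast
    have "range \<phi> = U" using \<phi>(3) by (simp add: bij_betw_def)
    then have "\<phi> \<in> Hom_W_V (Q_tr m1 m2 m3)" using \<phi> by (auto simp: Hom_W_V_def)
    then obtain L where L: "L \<in> D_W (BCCat m1 m2 m3)" "\<phi> = hom_of L"
      using bij_betw_hom_of[of m1 m2 m3] unfolding bij_betw_def by blast
    obtain v where "p = \<phi> v" using \<open>range \<phi> = U\<close> \<open>p \<in> U\<close> by blast
    then show "p \<in> realize ` ?F"
      by (intro image_eqI[of _ _ "Poly_Mapping.single (L, v) 1"]) (simp_all add: L tensor_free_single)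
  qed
  ultimately show "Q_tr_V m1 m2 m3 \<subseteq> realize ` ?F"
    unfolding Q_tr_V_def by (intro cpoly.span_minimal) blast+
next
  have hom: "hom_of L v \<in> Q_tr_V m1 m2 m3" if "L \<in> D_W (BCCat m1 m2 m3)" for L :: "'n cpoly \<Rightarrow> 'n cpoly" and v
  \<comment> \<open>The zero map does not parametrize a copy of \<open>V\<close>; its value 0 lies
    in the span anyway.\<close>
  proof (cases "L = 0")
    case True
    then show ?thesis by (simp add: hom_of_def Q_tr_V_def cpoly.span_zero)
  next
    case False
    then show ?thesis
      using invariant_copy_of_V[OF that] unfolding Q_tr_V_def by (intro cpoly.span_base) blast
  qed
  have "realize t \<in> Q_tr_V m1 m2 m3" if "t \<in> ?F" for t
    using that
  proof (induction t rule: tensor_free_induct)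
    case (single L v c)
    have "cscale c (hom_of L v) \<in> Q_tr_V m1 m2 m3"
      using hom[OF single(1)] unfolding Q_tr_V_def by (rule cpoly.span_scale)
    then show ?case by (simp add: cscale_def)
  qed (simp_all add: realize_add Q_tr_V_def cpoly.span_zero cpoly.span_add)
  then show "realize ` ?F \<subseteq> Q_tr_V m1 m2 m3" by blast
qed

text \<open>Values of an equivariant map into \<open>Q_tr\<close> are realized pure tensors, hence
  lie in the isotypic component.\<close>

lemma Hom_W_V_Q_tr_V: "Hom_W_V (Q_tr_V m1 m2 m3 :: 'n::{finite,linorder} cpoly set) = Hom_W_V (Q_tr m1 m2 m3)"
proof -
  have "realize t \<in> Q_tr m1 m2 m3" if "t \<in> tensor_free (D_W (BCCat m1 m2 m3 :: 'n cpoly)) UNIV" for t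
    using that
    by (induction t rule: tensor_free_induct)
      (simp_all add: realize_add Q_tr_0 Q_tr_add Q_tr_mult Const_invariants D_W_BCCat_iff)
  then have "Q_tr_V m1 m2 m3 \<subseteq> (Q_tr m1 m2 m3 :: 'n cpoly set)"
    unfolding Q_tr_V_eq_realize by blast
  moreover have "\<phi> v \<in> Q_tr_V m1 m2 m3" if \<phi>: "\<phi> \<in> Hom_W_V (Q_tr m1 m2 m3)"
    for \<phi> :: "(complex, 'n) vec \<Rightarrow> 'n cpoly" and v
  proof -
    obtain L where "L \<in> D_W (BCCat m1 m2 m3)" "\<phi> = hom_of L"
      using bij_betw_hom_of[of m1 m2 m3] \<phi> unfolding bij_betw_def by blast
    then show ?thesis
      unfolding Q_tr_V_eq_realize
      by (intro image_eqI[of _ _ "Poly_Mapping.single (L, v) 1"]) (simp_all add: tensor_free_single)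
  qed
  ultimately show ?thesis unfolding Hom_W_V_def by blast
qed

lemma Q_tr_V_isomorphic:
  "module_isomorphic invariants_W
     (Q_tr_V_module m1 m2 m3) (D_W_tensor_V_module (BCCat m1 m2 m3 :: 'n::{finite,linorder} cpoly))"
proof -
  let ?A = "D_W (BCCat m1 m2 m3 :: 'n cpoly)"
  let ?F = "tensor_free ?A UNIV"
  let ?E = "tensor_rel (\<lambda>c. scale_Der (Const c)) (*s) ?A UNIV"
  \<comment> \<open>The inverse of \<open>realize\<close> on classes: a polynomial goes to its whole
    fibre, which is one class, so the map is defined without choosing representatives.\<close>
  define G where "G q = {t \<in> ?F. realize t = q}" for q
  let ?act = "\<lambda>a t. \<Sum>w\<in>W. \<Sum>(L, v)\<in>Poly_Mapping.keys t.
    Poly_Mapping.single (scale_Der (a w) L, w v) (Poly_Mapping.lookup t (L, v))"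
  have eq_class: "?E `` {t} = G (realize t)" if "t \<in> ?F" for t
    using that by (auto simp: G_def tensor_rel_iff)
  have image: "Q_tr_V m1 m2 m3 = realize ` ?F" by (rule Q_tr_V_eq_realize)
  have bij: "bij_betw G (Q_tr_V m1 m2 m3) (?F // ?E)"
    unfolding bij_betw_def
  proof
    show "inj_on G (Q_tr_V m1 m2 m3)"
      by (rule inj_onI) (auto simp: image G_def)
    have "?F // ?E = (\<lambda>t. ?E `` {t}) ` ?F" by (auto simp: quotient_def)
    also have "\<dots> = (\<lambda>t. G (realize t)) ` ?F" using eq_class by (rule image_cong[OF refl])
    finally show "G ` Q_tr_V m1 m2 m3 = ?F // ?E" by (simp add: image image_image)
  qed
  have add: "G (p + q) = (\<Union>s\<in>G p. \<Union>t\<in>G q. ?E `` {s + t})"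
    if "p \<in> Q_tr_V m1 m2 m3" "q \<in> Q_tr_V m1 m2 m3" for p q
  proof -
    have "?E `` {s + t} = G (p + q)" if "s \<in> G p" "t \<in> G q" for s t
      using that eq_class[of "s + t"] by (simp add: G_def tensor_free_add realize_add)
    \<comment> \<open>All pairs of representatives give the same class; the union over them equals
      that class because the index sets are nonempty.\<close>
    moreover have "G p \<noteq> {}" "G q \<noteq> {}" using that by (auto simp: image G_def)
    ultimately show ?thesis by auto
  qed
  have smult: "G (\<Sum>w\<in>W. a w * act w q) = (\<Union>t\<in>G q. ?E `` {?act a t})"
    if a: "a \<in> invariants_W" and q: "q \<in> Q_tr_V m1 m2 m3" for a q
  proof -
    have "?E `` {?act a t} = G (\<Sum>w\<in>W. a w * act w q)" if t: "t \<in> G q" for t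
    proof -
      have A: "L \<in> ?A" if "(L, v) \<in> Poly_Mapping.keys t" for L v
        using t that by (auto simp: G_def tensor_free_def)
      have inv: "a w \<in> invariants" if "w \<in> W" for w
        using a that by (simp add: invariants_W_def)
      have "?act a t \<in> ?F"
        using A inv by (intro tensor_free_sum) (auto intro!: tensor_free_single D_W_scale)
      moreover have "realize (?act a t) = (\<Sum>w\<in>W. a w * act w (realize t))"
        unfolding realize_sum
      proof (rule sum.cong[OF refl])
        fix w :: "(complex, 'n) vec \<Rightarrow> (complex, 'n) vec" assume w: "w \<in> W"
        \<comment> \<open>Up to the coefficient, both sides are \<open>a w * hom_of L (w v)\<close>:
          invariance of \<open>L\<close> moves \<open>w\<close> from the polynomial to
          \<open>v\<close>.\<close>
        have "realize (case k of (L, v) \<Rightarrow>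
            Poly_Mapping.single (scale_Der (a w) L, w v) (Poly_Mapping.lookup t (L, v))) =
          a w * act w (case k of (L, v) \<Rightarrow> Const (Poly_Mapping.lookup t (L, v)) * hom_of L v)"
          if "k \<in> Poly_Mapping.keys t" for k
        proof -
          obtain L v where k: "k = (L, v)" by (cases k)
          then have "L \<in> invariant_Der" using A that by (auto simp: D_W_BCCat_iff)
          then show ?thesis
            by (simp add: k hom_of_scale_Der hom_of_equivariant w mult.left_commute)
        qed
        then show "(\<Sum>k\<in>Poly_Mapping.keys t. realize (case k of (L, v) \<Rightarrow>
            Poly_Mapping.single (scale_Der (a w) L, w v) (Poly_Mapping.lookup t (L, v)))) =
          a w * act w (realize t)"
          by (simp add: realize_def act_sum sum_distrib_left)
      qed
      ultimately show ?thesis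
        using eq_class[of "?act a t"] t by (simp add: G_def)
    qed
    moreover have "G q \<noteq> {}" using q by (auto simp: image G_def)
    ultimately show ?thesis by auto
  qed
  show ?thesis
    unfolding module_isomorphic_def
    by (rule exI[of _ G])
      (simp add: Q_tr_V_module_def D_W_tensor_V_module_def Let_def bij add smult)
qed

lemma Hom_W_V_isomorphic:
  "module_isomorphic invariants
     (Hom_W_V_module (Q_tr_V m1 m2 m3)) (D_W_module (BCCat m1 m2 m3 :: 'n::{finite,linorder} cpoly))"
proof -
  let ?A = "D_W (BCCat m1 m2 m3 :: 'n cpoly)" and ?H = "Hom_W_V (Q_tr m1 m2 m3 :: 'n cpoly set)"
  let ?G = "inv_into ?A hom_of"
  have bij: "bij_betw ?G ?H ?A" by (rule bij_betw_inv_into[OF bij_betw_hom_of])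
  have G: "?G (hom_of L) = L" if "L \<in> ?A" for L
    using bij_betw_hom_of that by (rule bij_betw_inv_into_left)
  have obt: "\<exists>L\<in>?A. \<phi> = hom_of L" if "\<phi> \<in> ?H" for \<phi>
    using bij_betw_hom_of[of m1 m2 m3] that unfolding bij_betw_def by blast
  have add: "?G (\<phi> + \<psi>) = ?G \<phi> + ?G \<psi>" if \<phi>: "\<phi> \<in> ?H" and \<psi>: "\<psi> \<in> ?H" for \<phi> \<psi>
  proof -
    obtain L L' where L: "L \<in> ?A" "\<phi> = hom_of L" "L' \<in> ?A" "\<psi> = hom_of L'"
      using obt[OF \<phi>] obt[OF \<psi>] by blast
    have "\<phi> + \<psi> = hom_of (L + L')" by (simp add: L fun_eq_iff hom_of_add_left)
    then show ?thesis using L D_W_add[OF L(1,3)] by (simp only: G)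
  qed
  have smult: "?G (\<lambda>v. f * \<phi> v) = scale_Der f (?G \<phi>)" if f: "f \<in> invariants" and \<phi>: "\<phi> \<in> ?H" for f \<phi>
  proof -
    obtain L where L: "L \<in> ?A" "\<phi> = hom_of L" using obt[OF \<phi>] by blast
    have "(\<lambda>v. f * \<phi> v) = hom_of (scale_Der f L)" by (simp add: L fun_eq_iff hom_of_scale_Der)
    then show ?thesis using L D_W_scale[OF f L(1)] by (simp only: G)
  qed
  show ?thesis
    unfolding module_isomorphic_def
    by (rule exI[of _ ?G]) (simp add: Hom_W_V_module_def D_W_module_def Hom_W_V_Q_tr_V bij add smult)
qed

theorem theorem5p11:
  fixes m :: "complex ^ 'n::{finite,linorder} \<Rightarrow> nat" and m1 m2 m3 :: nat
  assumes "W_invariant_multiplicity m"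
    and "\<And>i. m (e i) = m1"
    and "\<And>i. m (2 *s e i) = m2"
    and "\<And>i j. i < j \<Longrightarrow> m (e i + e j) = m3 \<and> m (e i - e j) = m3"
  shows "module_isomorphic invariants_W
           (Q_tr_V_module m1 m2 m3) (D_W_tensor_V_module (BCCat m1 m2 m3 :: 'n cpoly))
       \<and> module_isomorphic invariants
           (Hom_W_V_module (Q_tr_V m1 m2 m3)) (D_W_module (BCCat m1 m2 m3 :: 'n cpoly))"
  using Q_tr_V_isomorphic Hom_W_V_isomorphic by blast

end
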